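(* For all integers $n \ge 1$ and $1 \le i \le n$, the coefficient of the diagram $g_{n,i}$ in the Jones-Wenzl idempotent $f^{(n)} \in TL_n$ is $$\operatorname{coeff}_{\in f^{(n)}}(g_{n,i}) = \frac{[i]}{[n]},$$ and for every $n \ge 1$ the Jones-Wenzl idempotents satisfy, in $TL_{n+1}$, $$f^{(n+1)} = \frac{f^{(n)}}{[n+1]}\left(\sum_{i=1}^{n+1} [i]\, g_{n+1,i}\right).$$
   Context: Quantum integers: $[n] = \frac{q^n-q^{-n}}{q-q^{-1}} = q^{n-1}+q^{n-3}+\cdots+q^{-(n-1)}$, with $q$ a formal parameter. Temperley-Lieb algebra: an $n$ strand Temperley-Lieb diagram is an isotopy class of planar diagrams in a rectangle with $n$ marked points on the upper edge and $n$ on the lower edge (each numbered $1,\dots,n$ from left to right), consisting of non-intersecting arcs joining these $2n$ points in pairs. An arc joining two upper points is a cup, an arc joining two lower points is a cap, other arcs are through strands. $TL_n$ is the algebra over $\mathbb{C}(q)$ with basis the $n$ strand diagrams, and product $ab$ given by stacking $a$ on top of $b$ (lower edge of $a$ glued to upper edge of $b$), each closed loop being removed and replaced by a factor $-[2]$. $\mathbf{1}$ denotes the identity diagram, and $e_i$ ($1\le i\le n-1$) the diagram with a cup joining upper points $i,i+1$, a cap joining lower points $i,i+1$, and all other strands vertical. $TL_n$ is regarded as a subalgebra of $TL_{n+1}$ by adding a vertical strand on the right; in this way $f^{(n)}$ is viewed as an element of $TL_{n+1}$. Jones-Wenzl idempotent: $f^{(n)} \in TL_n$ is the unique element with $f^{(n)}\neq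 0$, $f^{(n)}f^{(n)}=f^{(n)}$, and $e_i f^{(n)} = f^{(n)} e_i = 0$ for all $i\in\{1,\dots,n-1\}$. For a diagram $D$, $\operatorname{coeff}_{\in f^{(n)}}(D)$ is the coefficient of $D$ when $f^{(n)}$ is expanded in the diagram basis of $TL_n$. Diagrams $g_{n,i}$: for $1\le i\le n-1$, $g_{n,i}$ is the $n$ strand diagram with exactly one cup, joining upper points $n-1$ and $n$, exactly one cap, joining lower points $i$ and $i+1$, and all remaining points joined by through strands. Also $g_{n,n}=\mathbf{1}$. *)

theory Defs
  imports
    "HOL-Library.Poly_Mapping"
    "HOL-Library.Disjoint_Sets"
    "HOL-Computational_Algebra.Polynomial"
    "HOL-Computational_Algebra.Fraction_Field"
begin

type_synonym ratfun = "complex poly fract"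

definition qvar :: ratfun where
  "qvar = Fract [:0, 1:] 1"

definition qint :: "nat \<Rightarrow> ratfun" where
  "qint n = (qvar ^ n - 1 / qvar ^ n) / (qvar - 1 / qvar)"

text \<open>
  An isotopy class of planar diagrams is determined by which marked points it joins, so a
  diagram is represented by its set of arcs, each arc being the set of its two end points.
\<close>

datatype point = Upper nat | Lower nat

type_synonym diagram = "point set set"

definition points :: "nat \<Rightarrow> point set" where
  "points n = Upper ` {1..n} \<union> Lower ` {1..n}"

text \<open>
  Position of a marked point when the boundary of the rectangle is traversed clockwise: the
  upper edge from left to right, then the lower edge from right to left.  Two arcs inside the
  rectangle can be drawn disjointly iff their end points do not interleave in this order.
\<close>

fun bpos :: "nat \<Rightarrow> point \<Rightarrow> nat" where
  "bpos n (Upper i) = i"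
| "bpos n (Lower i) = 2 * n + 1 - i"

definition crossing :: "nat \<Rightarrow> point set \<Rightarrow> point set \<Rightarrow> bool" where
  "crossing n A B \<longleftrightarrow> (\<exists>a b c d. A = {a, b} \<and> B = {c, d} \<and>
     bpos n a < bpos n c \<and> bpos n c < bpos n b \<and> bpos n b < bpos n d)"

definition tl_diagrams :: "nat \<Rightarrow> diagram set" where
  "tl_diagrams n = {D. partition_on (points n) D \<and> (\<forall>A\<in>D. card A = 2) \<and>
     (\<forall>A\<in>D. \<forall>B\<in>D. \<not> crossing n A B)}"

definition id_diagram :: "nat \<Rightarrow> diagram" where
  "id_diagram n = {{Upper j, Lower j} | j. j \<in> {1..n}}"

definition e_diagram :: "nat \<Rightarrow> nat \<Rightarrow> diagram" where
  "e_diagram n i = {{Upper i, Upper (i + 1)}, {Lower i, Lower (i + 1)}} \<union>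
     {{Upper j, Lower j} | j. j \<in> {1..n} - {i, i + 1}}"

text \<open>
  Since through strands cannot cross, they join the upper points \<open>1, \<dots>, n - 2\<close> in
  increasing order to the lower points other than \<open>i\<close> and \<open>i + 1\<close>.
\<close>

definition g_diagram :: "nat \<Rightarrow> nat \<Rightarrow> diagram" where
  "g_diagram n i = (if i = n then id_diagram n else
     {{Upper (n - 1), Upper n}, {Lower i, Lower (i + 1)}} \<union>
     {{Upper j, Lower j} | j. 1 \<le> j \<and> j < i} \<union>
     {{Upper j, Lower (j + 2)} | j. i \<le> j \<and> j + 2 \<le> n})"

text \<open>
  In the stacking of \<open>A\<close> on top of \<open>B\<close>, the lower points of \<open>A\<close> and the upper points of \<open>B\<close>
  become the points \<open>Mid i\<close>.
\<close>

datatype stack_point = Top nat | Mid nat | Bot nat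

fun to_top :: "point \<Rightarrow> stack_point" where
  "to_top (Upper i) = Top i"
| "to_top (Lower i) = Mid i"

fun to_bot :: "point \<Rightarrow> stack_point" where
  "to_bot (Upper i) = Mid i"
| "to_bot (Lower i) = Bot i"

fun to_outer :: "point \<Rightarrow> stack_point" where
  "to_outer (Upper i) = Top i"
| "to_outer (Lower i) = Bot i"

definition stack_arcs :: "diagram \<Rightarrow> diagram \<Rightarrow> stack_point set set" where
  "stack_arcs A B = image to_top ` A \<union> image to_bot ` B"

definition stack_conn :: "diagram \<Rightarrow> diagram \<Rightarrow> stack_point rel" where
  "stack_conn A B = {(x, y). \<exists>E\<in>stack_arcs A B. x \<in> E \<and> y \<in> E}\<^sup>*"

definition stack_diagram :: "nat \<Rightarrow> diagram \<Rightarrow> diagram \<Rightarrow> diagram" where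
  "stack_diagram n A B = {{x, y} | x y. x \<in> points n \<and> y \<in> points n \<and> x \<noteq> y \<and>
     (to_outer x, to_outer y) \<in> stack_conn A B}"

text \<open>The closed loops are the connected components that avoid the outer boundary.\<close>

definition stack_loops :: "nat \<Rightarrow> diagram \<Rightarrow> diagram \<Rightarrow> nat" where
  "stack_loops n A B =
     card {C. (\<exists>i\<in>{1..n}. C = stack_conn A B `` {Mid i}) \<and> C \<subseteq> range Mid}"

text \<open>
  Formal linear combinations of diagrams; the coefficient of \<open>D\<close> in \<open>x\<close> is
  \<open>Poly_Mapping.lookup x D\<close>.  The convolution product of \<open>Poly_Mapping\<close> plays no role.
\<close>

type_synonym tl_elem = "diagram \<Rightarrow>\<^sub>0 ratfun"

definition TL :: "nat \<Rightarrow> tl_elem set" where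
  "TL n = {x. Poly_Mapping.keys x \<subseteq> tl_diagrams n}"

definition tl_basis :: "diagram \<Rightarrow> tl_elem" where
  "tl_basis D = Poly_Mapping.single D 1"

definition tl_scale :: "ratfun \<Rightarrow> tl_elem \<Rightarrow> tl_elem" where
  "tl_scale c x = Poly_Mapping.map ((*) c) x"

definition tl_mult :: "nat \<Rightarrow> tl_elem \<Rightarrow> tl_elem \<Rightarrow> tl_elem" where
  "tl_mult n x y = (\<Sum>A\<in>Poly_Mapping.keys x. \<Sum>B\<in>Poly_Mapping.keys y.
     tl_scale (Poly_Mapping.lookup x A * Poly_Mapping.lookup y B * (- qint 2) ^ stack_loops n A B)
       (tl_basis (stack_diagram n A B)))"

text \<open>The inclusion of \<open>TL n\<close> into \<open>TL (n + 1)\<close>, adding a vertical strand on the right.\<close>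

definition tl_embed :: "nat \<Rightarrow> tl_elem \<Rightarrow> tl_elem" where
  "tl_embed n x = (\<Sum>D\<in>Poly_Mapping.keys x.
     tl_scale (Poly_Mapping.lookup x D)
       (tl_basis (insert {Upper (n + 1), Lower (n + 1)} D)))"

definition is_jones_wenzl :: "nat \<Rightarrow> tl_elem \<Rightarrow> bool" where
  "is_jones_wenzl n f \<longleftrightarrow> f \<in> TL n \<and> f \<noteq> 0 \<and> tl_mult n f f = f \<and>
     (\<forall>i\<in>{1..<n}. tl_mult n (tl_basis (e_diagram n i)) f = 0 \<and>
                 tl_mult n f (tl_basis (e_diagram n i)) = 0)"

definition jones_wenzl :: "nat \<Rightarrow> tl_elem" where
  "jones_wenzl n = (THE f. is_jones_wenzl n f)"

end

theory Submission
  imports Defs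
begin

text \<open>
  Let \<open>h = f\<^bsup>(n)\<^esup> (\<Sum>i. [i] g\<^bsub>n+1,i\<^esub>) / [n+1]\<close>.  Right multiplication by \<open>e\<^bsub>j\<^esub>\<close> sends each of
  \<open>g\<^bsub>n+1,j-1\<^esub>\<close>, \<open>g\<^bsub>n+1,j\<^esub>\<close>, \<open>g\<^bsub>n+1,j+1\<^esub>\<close> to a multiple of \<open>g\<^bsub>n+1,j\<^esub>\<close>, with total coefficient
  \<open>[j-1] - [2][j] + [j+1] = 0\<close>, and any other \<open>g\<^bsub>n+1,i\<^esub>\<close> to a diagram having a cup among the
  first \<open>n\<close> upper points, which is killed by \<open>f\<^bsup>(n)\<^esup>\<close>.  Hence \<open>h e\<^bsub>j\<^esub> = 0\<close> for all \<open>j\<close>.  As every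
  planar diagram other than the identity has a short cup and a short cap, an element with
  identity coefficient 1 that is killed from the right by all generators is invariant under
  reflection, and therefore is the Jones-Wenzl idempotent.  Only the identity term of \<open>f\<^bsup>(n)\<^esup>\<close>
  contributes to the coefficient of \<open>g\<^bsub>n+1,j\<^esub>\<close> in \<open>h\<close>, which is thus \<open>[j]/[n+1]\<close>.
\<close>

subsection \<open>Arcs and connectivity\<close>

text \<open>Stacking is defined through a transitive closure, so products cannot simply be
  evaluated. Only products with a generator on the right are worked out arc by arc. Those with a
  generator on the left follow by reflection, and those with a \<open>g\<close> diagram from the
  relation g(n,i) = g(n,i+1) e_i, which starts at g(n,n) = 1. A diagram D with a cup at k satisfies
  e_k D = -[2] D; since [2] is invertible, f e_k = 0 then gives f D = 0. This argument needs
  associativity, loop factors included, and is the reason for the contraction of connectivity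
  graphs. The invariant of the induction is one-sided, because annihilation from the left is not
  visible on the formula; existence of the idempotent comes out of the same induction. The quantum
  integers enter as the weights solving x(j-1) - [2] x(j) + x(j+1) = 0 with x(0) = 0, and division
  by [n+1] normalises the identity coefficient.\<close>

definition arc_conn :: "'a set set \<Rightarrow> 'a rel" where
  "arc_conn \<A> = {(x, y). \<exists>E\<in>\<A>. x \<in> E \<and> y \<in> E}\<^sup>*"

text \<open>Connectivity is developed over an arbitrary point type, so that the same facts serve
  double stacks and triple stacks with their four levels.\<close>

lemma stack_conn_eq: "stack_conn A B = arc_conn (stack_arcs A B)"
  by (simp add: stack_conn_def arc_conn_def)

lemma arc_conn_refl [simp]: "(x, x) \<in> arc_conn \<A>"
  by (simp add: arc_conn_def)

lemma arc_conn_arc: "E \<in> \<A> \<Longrightarrow> x \<in> E \<Longrightarrow> y \<in> E \<Longrightarrow> (x, y) \<in> arc_conn \<A>"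
  unfolding arc_conn_def by (rule r_into_rtrancl) blast

lemma arc_conn_trans: "(x, y) \<in> arc_conn \<A> \<Longrightarrow> (y, z) \<in> arc_conn \<A> \<Longrightarrow> (x, z) \<in> arc_conn \<A>"
  unfolding arc_conn_def by (rule rtrancl_trans)

lemma arc_conn_sym: "(x, y) \<in> arc_conn \<A> \<Longrightarrow> (y, x) \<in> arc_conn \<A>"
proof -
  have "sym {(x, y). \<exists>E\<in>\<A>. x \<in> E \<and> y \<in> E}"
    by (auto simp: sym_def)
  then show "(x, y) \<in> arc_conn \<A> \<Longrightarrow> (y, x) \<in> arc_conn \<A>"
    unfolding arc_conn_def by (rule symD[OF sym_rtrancl])
qed

lemma arc_conn_induct [consumes 1, case_names refl step]:
  assumes "(x, y) \<in> arc_conn \<A>"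
    and "P x"
    and "\<And>y z E. (x, y) \<in> arc_conn \<A> \<Longrightarrow> E \<in> \<A> \<Longrightarrow> y \<in> E \<Longrightarrow> z \<in> E \<Longrightarrow> P y \<Longrightarrow> P z"
  shows "P y"
  using assms(1) unfolding arc_conn_def
proof (induction rule: rtrancl_induct)
  case base
  then show ?case by (rule assms(2))
next
  case (step y z)
  then show ?case using assms(3)[of y _ z] unfolding arc_conn_def by blast
qed

text \<open>The standard way to bound a component from above: a set that no arc leaves traps every
  path starting in it.\<close>

lemma arc_conn_closed:
  assumes "(x, y) \<in> arc_conn \<A>" "x \<in> S" "\<And>E. E \<in> \<A> \<Longrightarrow> E \<inter> S \<noteq> {} \<Longrightarrow> E \<subseteq> S"
  shows "y \<in> S"
  using assms(1) by (induction rule: arc_conn_induct) (use assms in blast)+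

lemma arc_conn_mono:
  assumes "(x, y) \<in> arc_conn \<A>" "\<And>E u v. E \<in> \<A> \<Longrightarrow> u \<in> E \<Longrightarrow> v \<in> E \<Longrightarrow> (u, v) \<in> arc_conn \<B>"
  shows "(x, y) \<in> arc_conn \<B>"
  using assms(1) by (induction rule: arc_conn_induct) (auto intro: arc_conn_trans assms(2))

lemma arc_conn_Un: "(x, y) \<in> arc_conn \<A> \<Longrightarrow> (x, y) \<in> arc_conn (\<A> \<union> \<B>)"
  by (erule arc_conn_mono) (blast intro: arc_conn_arc)

lemma arc_conn_field: "(x, y) \<in> arc_conn \<A> \<Longrightarrow> x = y \<or> x \<in> \<Union>\<A> \<and> y \<in> \<Union>\<A>"
  by (induction rule: arc_conn_induct) auto

lemma arc_conn_image_iff: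
  assumes "inj f"
  shows "(f x, y) \<in> arc_conn (image f ` \<A>) \<longleftrightarrow> (\<exists>z. y = f z \<and> (x, z) \<in> arc_conn \<A>)"
proof
  assume "(f x, y) \<in> arc_conn (image f ` \<A>)"
  then show "\<exists>z. y = f z \<and> (x, z) \<in> arc_conn \<A>"
  proof (induction rule: arc_conn_induct)
    case refl
    then show ?case by auto
  next
    case (step y z E)
    then obtain u where u: "y = f u" "(x, u) \<in> arc_conn \<A>" by blast
    from step.hyps obtain E' where E': "E' \<in> \<A>" "E = f ` E'" by blast
    then have "u \<in> E'" using step u \<open>inj f\<close> by (auto dest: injD)
    moreover obtain v where "z = f v" "v \<in> E'" using step E' by blast
    ultimately show ?case using u E' arc_conn_arc arc_conn_trans by metis
  qed
next
  assume "\<exists>z. y = f z \<and> (x, z) \<in> arc_conn \<A>"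
  then obtain z where z: "y = f z" "(x, z) \<in> arc_conn \<A>" by blast
  from z(2) have "(f x, f z) \<in> arc_conn (image f ` \<A>)"
    by (induction rule: arc_conn_induct) (auto intro: arc_conn_trans arc_conn_arc)
  with z show "(f x, y) \<in> arc_conn (image f ` \<A>)" by simp
qed

lemma arc_conn_image [simp]:
  assumes "inj f"
  shows "(f x, f y) \<in> arc_conn (image f ` \<A>) \<longleftrightarrow> (x, y) \<in> arc_conn \<A>"
  using assms by (auto simp: arc_conn_image_iff dest: injD)

lemma arc_conn_image_component:
  assumes "inj f"
  shows "arc_conn (image f ` \<A>) `` {f x} = f ` (arc_conn \<A> `` {x})"
  using assms by (auto simp: arc_conn_image_iff)

text \<open>Closed loops in abstract form: \<open>X\<close> holds the interior points and
  \<open>Z\<close> the boundary. Components are counted as sets, so a loop through several interior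
  points counts once.\<close>

definition inner_comps :: "'a set set \<Rightarrow> 'a set \<Rightarrow> 'a set \<Rightarrow> 'a set set" where
  "inner_comps \<A> X Z = {K. (\<exists>x\<in>X. K = arc_conn \<A> `` {x}) \<and> K \<inter> Z = {}}"

lemma finite_inner_comps: "finite X \<Longrightarrow> finite (inner_comps \<A> X Z)"
  unfolding inner_comps_def by (rule finite_subset[of _ "(\<lambda>x. arc_conn \<A> `` {x}) ` X"]) auto

lemma card_inner_comps_image:
  assumes "inj f"
  shows "card (inner_comps (image f ` \<A>) (f ` X) Z) = card (inner_comps \<A> X (f -` Z))"
proof -
  have "inner_comps (image f ` \<A>) (f ` X) Z = image f ` inner_comps \<A> X (f -` Z)"
    unfolding inner_comps_def using assms
    by (auto simp: arc_conn_image_component image_iff)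
  moreover have "inj_on (image f) (inner_comps \<A> X (f -` Z))"
    using assms by (simp add: inj_on_def inj_image_eq_iff)
  ultimately show ?thesis by (simp add: card_image)
qed

text \<open>The chords that a web of arcs induces on its visible points \<open>V\<close>; this is
  what stacking does to two diagrams once the middle edge is forgotten.\<close>

definition joined :: "'a set \<Rightarrow> 'a set set \<Rightarrow> 'a set set" where
  "joined V \<A> = {{x, y} | x y. x \<in> V \<and> y \<in> V \<and> x \<noteq> y \<and> (x, y) \<in> arc_conn \<A>}"

section \<open>Contraction of a subgraph to the chords it induces\<close>

context
  fixes \<A> \<B> :: "'a set set" and V W :: "'a set"
  assumes \<B>: "\<Union>\<B> \<subseteq> W" and V: "V \<subseteq> W" "\<Union>\<A> \<inter> W \<subseteq> V"
begin

lemma joined_conn: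
  assumes "w \<in> W" "y \<in> W" "(w, y) \<in> arc_conn \<A>"
  shows "(w, y) \<in> arc_conn (joined V \<A> \<union> \<B>)"
proof (cases "w = y")
  case False
  then have "w \<in> V" "y \<in> V" using arc_conn_field[OF assms(3)] assms V by auto
  then have "{w, y} \<in> joined V \<A>" using False assms unfolding joined_def by blast
  then show ?thesis by (auto intro: arc_conn_arc)
qed simp

text \<open>A path between points of \<open>W\<close> splits into arcs of \<open>\<B>\<close> and
  excursions through \<open>\<A>\<close>. Each excursion starts and ends in \<open>V\<close>,
  because \<open>\<A>\<close> meets \<open>W\<close> only there, and can be replaced by a single
  chord.\<close>

lemma arc_conn_contract:
  assumes "x \<in> W" "y \<in> W"
  shows "(x, y) \<in> arc_conn (joined V \<A> \<union> \<B>) \<longleftrightarrow> (x, y) \<in> arc_conn (\<A> \<union> \<B>)"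
proof
  assume "(x, y) \<in> arc_conn (joined V \<A> \<union> \<B>)"
  then show "(x, y) \<in> arc_conn (\<A> \<union> \<B>)"
    by (rule arc_conn_mono)
      (auto simp: joined_def intro: arc_conn_Un arc_conn_sym arc_conn_arc)
next
  assume "(x, y) \<in> arc_conn (\<A> \<union> \<B>)"
  \<comment> \<open>The current point may lie outside \<open>W\<close>, so the induction remembers
    the last visited point \<open>w\<close> of \<open>W\<close>, after which only arcs of
    \<open>\<A>\<close> were used.\<close>
  then have "\<exists>w\<in>W. (x, w) \<in> arc_conn (joined V \<A> \<union> \<B>) \<and> (w, y) \<in> arc_conn \<A>"
  proof (induction rule: arc_conn_induct)
    case refl
    then show ?case using assms(1) by (intro bexI[of _ x]) simp_all
  next
    case (step y z E)
    then obtain w where w: "w \<in> W" "(x, w) \<in> arc_conn (joined V \<A> \<union> \<B>)" "(w, y) \<in> arc_conn \<A>"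
      by blast
    show ?case
    proof (cases "E \<in> \<A>")
      case True
      then show ?thesis using w step arc_conn_arc arc_conn_trans by metis
    next
      case False
      then have "E \<in> \<B>" using step by blast
      then have "y \<in> W" "z \<in> W" "(y, z) \<in> arc_conn (joined V \<A> \<union> \<B>)"
        using step \<B> by (auto intro: arc_conn_arc)
      then show ?thesis using w joined_conn arc_conn_trans arc_conn_refl by metis
    qed
  qed
  then show "(x, y) \<in> arc_conn (joined V \<A> \<union> \<B>)"
    using joined_conn assms arc_conn_trans by metis
qed

lemma joined_component_subset:
  assumes "x \<in> W" shows "arc_conn (joined V \<A> \<union> \<B>) `` {x} \<subseteq> W"
proof
  fix y assume "y \<in> arc_conn (joined V \<A> \<union> \<B>) `` {x}"
  then have "(x, y) \<in> arc_conn (joined V \<A> \<union> \<B>)" by simp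
  then show "y \<in> W"
    by (rule arc_conn_closed) (use assms \<B> V in \<open>auto simp: joined_def\<close>)
qed

text \<open>Loops that avoid \<open>W\<close> consist of arcs of \<open>\<A>\<close> alone and
  disappear in the contraction. Loops that meet \<open>W\<close> survive, the surviving loop being
  the trace \<open>K \<inter> W\<close>.\<close>

lemma card_inner_comps_contract:
  assumes X: "finite X1" "finite X2" "X1 \<inter> W = {}" "X2 \<subseteq> W"
    and Z: "Z \<subseteq> W" "(\<Union>\<A> \<union> \<Union>\<B>) \<inter> W \<subseteq> X2 \<union> Z"
  shows "card (inner_comps (\<A> \<union> \<B>) (X1 \<union> X2) Z) =
    card (inner_comps \<A> X1 W) + card (inner_comps (joined V \<A> \<union> \<B>) X2 Z)"
proof -
  let ?c = "\<lambda>x. arc_conn (\<A> \<union> \<B>) `` {x}"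
  let ?G = "inner_comps (\<A> \<union> \<B>) (X1 \<union> X2) Z"
  let ?G1 = "{K \<in> ?G. K \<inter> W = {}}" and ?G2 = "{K \<in> ?G. K \<inter> W \<noteq> {}}"
  \<comment> \<open>Arcs of \<open>\<B>\<close> lie inside \<open>W\<close>, so they cannot enlarge
    a component that stays away from \<open>W\<close>.\<close>
  have avoid: "arc_conn \<A> `` {x} = ?c x" if "arc_conn \<A> `` {x} \<inter> W = {}" for x
  proof (intro subset_antisym subsetI)
    fix y assume "y \<in> ?c x"
    then have "(x, y) \<in> arc_conn (\<A> \<union> \<B>)" by simp
    then show "y \<in> arc_conn \<A> `` {x}"
    proof (rule arc_conn_closed)
      fix E assume "E \<in> \<A> \<union> \<B>" and ne: "E \<inter> arc_conn \<A> `` {x} \<noteq> {}"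
      moreover have "E \<notin> \<B>" using ne that \<B> by blast
      ultimately show "E \<subseteq> arc_conn \<A> `` {x}"
        using arc_conn_arc arc_conn_trans by fast
    qed simp
  qed (auto intro: arc_conn_Un)
  have "?G1 = inner_comps \<A> X1 W"
  proof (intro subset_antisym subsetI)
    fix K assume "K \<in> ?G1"
    then obtain x where x: "x \<in> X1 \<union> X2" "K = ?c x" "K \<inter> W = {}"
      unfolding inner_comps_def by blast
    have "arc_conn \<A> `` {x} \<subseteq> ?c x" by (auto intro: arc_conn_Un)
    then have "K = arc_conn \<A> `` {x}" using x avoid[of x] by blast
    moreover have "x \<in> K" using x by simp
    ultimately show "K \<in> inner_comps \<A> X1 W" using x X unfolding inner_comps_def by blast
  next
    fix K assume "K \<in> inner_comps \<A> X1 W"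
    then show "K \<in> ?G1" using avoid Z unfolding inner_comps_def by blast
  qed
  moreover have "bij_betw (\<lambda>K. K \<inter> W) ?G2 (inner_comps (joined V \<A> \<union> \<B>) X2 Z)"
  proof -
    have restrict: "?c x \<inter> W = arc_conn (joined V \<A> \<union> \<B>) `` {x}" if "x \<in> W" for x
      using joined_component_subset[OF that] arc_conn_contract[OF that] by blast
    have eq: "?c x = ?c y" if "(x, y) \<in> arc_conn (\<A> \<union> \<B>)" for x y
      using that arc_conn_trans arc_conn_sym by fast
    \<comment> \<open>A point of \<open>W\<close> lying on an arc is in \<open>X2\<close> or in
      \<open>Z\<close>, and \<open>K\<close> avoids \<open>Z\<close>; hence a loop meeting
      \<open>W\<close> can be represented by a point of \<open>X2\<close>.\<close>
    have rep: "\<exists>x\<in>X2. K = ?c x" if K: "K \<in> ?G2" for K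
    proof -
      from K obtain x w where x: "x \<in> X1 \<union> X2" "K = ?c x" "w \<in> K" "w \<in> W" "K \<inter> Z = {}"
        unfolding inner_comps_def by blast
      then have xw: "(x, w) \<in> arc_conn (\<A> \<union> \<B>)" by simp
      from arc_conn_field[OF xw] have "w \<in> X2" using x X Z by auto
      then show ?thesis using eq[OF xw] x by blast
    qed
    have G2: "?G2 = {K. (\<exists>x\<in>X2. K = ?c x) \<and> K \<inter> Z = {}}"
    proof (intro subset_antisym subsetI)
      fix K assume "K \<in> ?G2" then show "K \<in> {K. (\<exists>x\<in>X2. K = ?c x) \<and> K \<inter> Z = {}}"
        using rep[of K] unfolding inner_comps_def by blast
    next
      fix K assume "K \<in> {K. (\<exists>x\<in>X2. K = ?c x) \<and> K \<inter> Z = {}}"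
      then obtain x where x: "x \<in> X2" "K = ?c x" "K \<inter> Z = {}" by blast
      then have "x \<in> K \<inter> W" using X by auto
      then show "K \<in> ?G2" using x unfolding inner_comps_def by blast
    qed
    show ?thesis unfolding bij_betw_def
    proof
      show "inj_on (\<lambda>K. K \<inter> W) ?G2"
      proof (rule inj_onI)
        fix K K' assume K: "K \<in> ?G2" and "K' \<in> ?G2" and e: "K \<inter> W = K' \<inter> W"
        then obtain x x' where x: "x \<in> X2" "x' \<in> X2" "K = ?c x" "K' = ?c x'" using rep by meson
        then have "x \<in> K'" using X e by auto
        then show "K = K'" using x eq[of x' x] by simp
      qed
      have "(\<lambda>K. K \<inter> W) ` ?G2 = {K \<inter> W |K. (\<exists>x\<in>X2. K = ?c x) \<and> K \<inter> Z = {}}"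
        unfolding G2 by blast
      also have "\<dots> = {?c x \<inter> W | x. x \<in> X2 \<and> (?c x \<inter> W) \<inter> Z = {}}"
        using Z by blast
      also have "\<dots> = inner_comps (joined V \<A> \<union> \<B>) X2 Z"
        unfolding inner_comps_def using restrict X by blast
      finally show "(\<lambda>K. K \<inter> W) ` ?G2 = inner_comps (joined V \<A> \<union> \<B>) X2 Z" .
    qed
  qed
  then have "card ?G2 = card (inner_comps (joined V \<A> \<union> \<B>) X2 Z)"
    by (rule bij_betw_same_card)
  moreover have "card ?G = card ?G1 + card ?G2"
  proof -
    have "?G = ?G1 \<union> ?G2" by blast
    moreover have "finite ?G" using X by (simp add: finite_inner_comps)
    ultimately show ?thesis using card_Un_disjoint[of ?G1 ?G2] by fastforce
  qed
  ultimately show ?thesis by simp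
qed

end

subsection \<open>Associativity of stacking\<close>

text \<open>The four horizontal edges of a triple stack are the levels 0, 1, 2, 3 from top to bottom.\<close>

fun lev :: "nat \<Rightarrow> nat \<Rightarrow> point \<Rightarrow> nat \<times> nat" where
  "lev a b (Upper i) = (a, i)"
| "lev a b (Lower i) = (b, i)"

text \<open>Places a double stack on three of the four levels: when A and B are already multiplied,
  the stack over C uses levels 0, 2, 3; the other bracketing uses 0, 1, 3.\<close>

fun slev :: "nat \<Rightarrow> nat \<Rightarrow> nat \<Rightarrow> stack_point \<Rightarrow> nat \<times> nat" where
  "slev a b c (Top i) = (a, i)"
| "slev a b c (Mid i) = (b, i)"
| "slev a b c (Bot i) = (c, i)"

abbreviation lev_arcs :: "nat \<Rightarrow> nat \<Rightarrow> diagram \<Rightarrow> (nat \<times> nat) set set" where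
  "lev_arcs a b A \<equiv> image (lev a b) ` A"

lemma slev_to [simp]:
  "slev a b c (to_top x) = lev a b x"
  "slev a b c (to_bot x) = lev b c x"
  "slev a b c (to_outer x) = lev a c x"
  by (cases x; simp)+

lemma inj_slev: "distinct [a, b, c] \<Longrightarrow> inj (slev a b c)"
proof (rule injI)
  fix x y assume "distinct [a, b, c]" "slev a b c x = slev a b c y"
  then show "x = y" by (cases x; cases y) auto
qed

lemma slev_stack_arcs:
  "image (slev a b c) ` stack_arcs A B = lev_arcs a b A \<union> lev_arcs b c B"
  by (simp add: stack_arcs_def image_Un image_image)

lemma stack_conn_lev:
  assumes "distinct [a, b, c]"
  shows "(to_outer x, to_outer y) \<in> stack_conn A B \<longleftrightarrow>
    (lev a c x, lev a c y) \<in> arc_conn (lev_arcs a b A \<union> lev_arcs b c B)"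
  using arc_conn_image[OF inj_slev[OF assms], of "to_outer x" "to_outer y" "stack_arcs A B"]
  by (simp add: slev_stack_arcs stack_conn_eq)

lemma stack_diagram_iff:
  "{x, y} \<in> stack_diagram n A B \<longleftrightarrow>
    (x \<in> points n \<and> y \<in> points n \<and> (to_outer x, to_outer y) \<in> stack_conn A B \<and> x \<noteq> y)"
  unfolding stack_diagram_def stack_conn_eq by (auto simp: doubleton_eq_iff arc_conn_sym)

text \<open>Identifies the product of two diagrams with a contraction, so that the abstract results
  apply to stacking.\<close>

lemma lev_arcs_stack_diagram:
  assumes "distinct [a, b, c]"
  shows "lev_arcs a c (stack_diagram n A B) =
    joined (lev a c ` points n) (lev_arcs a b A \<union> lev_arcs b c B)"
proof -
  have inj: "lev a c x = lev a c y \<longleftrightarrow> x = y" for x y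
    using assms by (cases x; cases y) auto
  have "lev_arcs a c (stack_diagram n A B) = {{lev a c x, lev a c y} | x y.
      x \<in> points n \<and> y \<in> points n \<and> x \<noteq> y \<and>
      (lev a c x, lev a c y) \<in> arc_conn (lev_arcs a b A \<union> lev_arcs b c B)}"
    unfolding stack_diagram_def stack_conn_lev[OF assms] by (auto simp: image_def)
  also have "\<dots> = joined (lev a c ` points n) (lev_arcs a b A \<union> lev_arcs b c B)"
    unfolding joined_def using inj by blast
  finally show ?thesis .
qed

lemma lev_arcs_subset:
  assumes "A \<subseteq> Pow (points n)" "\<And>x. x \<in> points n \<Longrightarrow> lev a b x \<in> S"
  shows "\<Union>(lev_arcs a b A) \<subseteq> S"
  using assms by blast

lemma stack_loops_lev:
  assumes "distinct [a, b, c]" "a \<in> L" "c \<in> L" "b \<notin> L"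
  shows "stack_loops n A B =
    card (inner_comps (lev_arcs a b A \<union> lev_arcs b c B) ({b} \<times> {1..n}) (L \<times> UNIV))"
proof -
  have 1: "slev a b c -` (L \<times> UNIV) = - range Mid"
  proof (intro set_eqI)
    show "x \<in> slev a b c -` (L \<times> UNIV) \<longleftrightarrow> x \<in> - range Mid" for x
      using assms by (cases x) auto
  qed
  have 2: "slev a b c ` (Mid ` {1..n}) = {b} \<times> {1..n}" by force
  have "stack_loops n A B = card (inner_comps (stack_arcs A B) (Mid ` {1..n}) (- range Mid))"
    unfolding stack_loops_def inner_comps_def stack_conn_eq
    by (rule arg_cong[where f = card]) blast
  also have "\<dots> = card (inner_comps (lev_arcs a b A \<union> lev_arcs b c B) ({b} \<times> {1..n}) (L \<times> UNIV))"
    using card_inner_comps_image[OF inj_slev[OF assms(1)], of "stack_arcs A B" "Mid ` {1..n}" "L \<times> UNIV"]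
    by (simp only: 1 2 slev_stack_arcs)
  finally show ?thesis .
qed

context
  fixes n a b c :: nat and A B :: diagram and \<B> :: "(nat \<times> nat) set set"
  assumes levels: "distinct [a, b, c]"
    and AB: "A \<subseteq> Pow (points n)" "B \<subseteq> Pow (points n)"
    and \<B>: "\<Union>\<B> \<subseteq> (- {b}) \<times> {1..n}"
begin

lemma lev_arcs_Union:
  "\<Union>(lev_arcs a b A \<union> lev_arcs b c B) \<inter> (- {b}) \<times> UNIV \<subseteq> lev a c ` points n"
proof -
  let ?S = "{z. z \<in> (- {b}) \<times> UNIV \<longrightarrow> z \<in> lev a c ` points n}"
  have "lev a b x \<in> ?S" if "x \<in> points n" for x
  proof (cases x)
    case (Upper i)
    then have "lev a b x = lev a c x" by simp
    then show ?thesis using that by simp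
  qed simp
  moreover have "lev b c x \<in> ?S" if "x \<in> points n" for x
  proof (cases x)
    case (Lower i)
    then have "lev b c x = lev a c x" by simp
    then show ?thesis using that by simp
  qed simp
  ultimately have "\<Union>(lev_arcs a b A) \<subseteq> ?S" "\<Union>(lev_arcs b c B) \<subseteq> ?S"
    using AB by (simp_all only: lev_arcs_subset)
  then have "\<Union>(lev_arcs a b A \<union> lev_arcs b c B) \<subseteq> ?S"
    by (simp only: Union_Un_distrib Un_subset_iff)
  then show ?thesis by (simp only: subset_iff Int_iff mem_Collect_eq imp_conjL simp_thms)
qed

lemma lev_points: "lev a c ` points n \<subseteq> (- {b}) \<times> {1..n}"
  using levels by (auto simp: points_def)

lemma stack_contract_conn:
  assumes "x \<in> (- {b}) \<times> UNIV" "y \<in> (- {b}) \<times> UNIV"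
  shows "(x, y) \<in> arc_conn (lev_arcs a c (stack_diagram n A B) \<union> \<B>) \<longleftrightarrow>
    (x, y) \<in> arc_conn (lev_arcs a b A \<union> lev_arcs b c B \<union> \<B>)"
  unfolding lev_arcs_stack_diagram[OF levels]
  by (rule arc_conn_contract[where W = "(- {b}) \<times> UNIV"])
    (use assms lev_arcs_Union lev_points \<B> in auto)

text \<open>Here \<open>m\<close> is the other inner level. Loops of the triple stack either close
  up inside the pair that is multiplied first, or appear when the product is stacked with the third
  diagram.\<close>

lemma stack_contract_loops:
  assumes "m \<noteq> b"
  shows "card (inner_comps (lev_arcs a b A \<union> lev_arcs b c B \<union> \<B>)
      ({b, m} \<times> {1..n}) ((- {b, m}) \<times> UNIV)) =
    stack_loops n A B + card (inner_comps (lev_arcs a c (stack_diagram n A B) \<union> \<B>)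
      ({m} \<times> {1..n}) ((- {b, m}) \<times> UNIV))"
proof -
  have "stack_loops n A B =
    card (inner_comps (lev_arcs a b A \<union> lev_arcs b c B) ({b} \<times> {1..n}) ((- {b}) \<times> UNIV))"
    using levels by (intro stack_loops_lev) auto
  moreover have "{b, m} \<times> {1..n} = {b} \<times> {1..n} \<union> {m} \<times> {1..n}" by auto
  moreover have "card (inner_comps (lev_arcs a b A \<union> lev_arcs b c B \<union> \<B>)
      ({b} \<times> {1..n} \<union> {m} \<times> {1..n}) ((- {b, m}) \<times> UNIV)) =
    card (inner_comps (lev_arcs a b A \<union> lev_arcs b c B) ({b} \<times> {1..n}) ((- {b}) \<times> UNIV)) +
    card (inner_comps (joined (lev a c ` points n) (lev_arcs a b A \<union> lev_arcs b c B) \<union> \<B>)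
      ({m} \<times> {1..n}) ((- {b, m}) \<times> UNIV))"
  proof (rule card_inner_comps_contract)
    show "\<Union>\<B> \<subseteq> (- {b}) \<times> UNIV" using \<B> by (rule order_trans) auto
    show "lev a c ` points n \<subseteq> (- {b}) \<times> UNIV" using lev_points by (rule order_trans) auto
    show "\<Union>(lev_arcs a b A \<union> lev_arcs b c B) \<inter> (- {b}) \<times> UNIV \<subseteq> lev a c ` points n"
      by (rule lev_arcs_Union)
    have "(\<Union>(lev_arcs a b A \<union> lev_arcs b c B) \<union> \<Union>\<B>) \<inter> (- {b}) \<times> UNIV \<subseteq> (- {b}) \<times> {1..n}"
      using order_trans[OF lev_arcs_Union lev_points] \<B>
      by (simp only: Int_Un_distrib2 Un_subset_iff le_infI1)
    then show "(\<Union>(lev_arcs a b A \<union> lev_arcs b c B) \<union> \<Union>\<B>) \<inter> (- {b}) \<times> UNIV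
        \<subseteq> {m} \<times> {1..n} \<union> (- {b, m}) \<times> UNIV"
      by (rule order_trans) auto
  qed (use assms in auto)
  ultimately show ?thesis by (simp only: lev_arcs_stack_diagram[OF levels])
qed

end

context
  fixes n :: nat and A B C :: diagram
  assumes ABC: "A \<subseteq> Pow (points n)" "B \<subseteq> Pow (points n)" "C \<subseteq> Pow (points n)"
begin

lemma lev_arcs_bounds:
  "\<Union>(lev_arcs 2 3 C) \<subseteq> (- {1}) \<times> {1..n}" "\<Union>(lev_arcs 0 1 A) \<subseteq> (- {2}) \<times> {1..n}"
proof -
  have "lev 2 3 x \<in> (- {1}) \<times> {1..n}" "lev 0 1 x \<in> (- {2}) \<times> {1..n}" if "x \<in> points n" for x
    using that by (auto simp: points_def)
  then show "\<Union>(lev_arcs 2 3 C) \<subseteq> (- {1}) \<times> {1..n}" "\<Union>(lev_arcs 0 1 A) \<subseteq> (- {2}) \<times> {1..n}"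
    using ABC by (simp_all only: lev_arcs_subset)
qed

text \<open>Both sides describe which outer points are connected in the triple stack: one bracketing
  contracts level 1, the other level 2.\<close>

lemma stack_diagram_assoc:
  "stack_diagram n (stack_diagram n A B) C = stack_diagram n A (stack_diagram n B C)"
proof -
  have outer: "lev 0 3 x \<in> (- {1}) \<times> UNIV" "lev 0 3 x \<in> (- {2}) \<times> UNIV" for x
    by (cases x; simp)+
  have "(to_outer x, to_outer y) \<in> stack_conn (stack_diagram n A B) C \<longleftrightarrow>
      (to_outer x, to_outer y) \<in> stack_conn A (stack_diagram n B C)" for x y
  proof -
    have "(to_outer x, to_outer y) \<in> stack_conn (stack_diagram n A B) C \<longleftrightarrow>
        (lev 0 3 x, lev 0 3 y) \<in> arc_conn (lev_arcs 0 2 (stack_diagram n A B) \<union> lev_arcs 2 3 C)"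
      by (rule stack_conn_lev) simp
    also have "\<dots> \<longleftrightarrow>
        (lev 0 3 x, lev 0 3 y) \<in> arc_conn (lev_arcs 0 1 A \<union> lev_arcs 1 2 B \<union> lev_arcs 2 3 C)"
      by (rule stack_contract_conn[OF _ ABC(1,2) lev_arcs_bounds(1) outer(1) outer(1)]) simp
    also have "\<dots> \<longleftrightarrow>
        (lev 0 3 x, lev 0 3 y) \<in> arc_conn (lev_arcs 1 2 B \<union> lev_arcs 2 3 C \<union> lev_arcs 0 1 A)"
      by (simp only: Un_ac)
    also have "\<dots> \<longleftrightarrow>
        (lev 0 3 x, lev 0 3 y) \<in> arc_conn (lev_arcs 1 3 (stack_diagram n B C) \<union> lev_arcs 0 1 A)"
      by (rule stack_contract_conn[OF _ ABC(2,3) lev_arcs_bounds(2) outer(2) outer(2), symmetric]) simp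
    also have "\<dots> \<longleftrightarrow> (to_outer x, to_outer y) \<in> stack_conn A (stack_diagram n B C)"
      unfolding Un_commute[of "lev_arcs 1 3 (stack_diagram n B C)"]
      by (rule stack_conn_lev[symmetric]) simp
    finally show ?thesis .
  qed
  then show ?thesis by (simp only: stack_diagram_def)
qed

text \<open>Both sums count the loops of the triple stack, that is, the components confined to
  levels 1 and 2.\<close>

lemma stack_loops_assoc:
  "stack_loops n A B + stack_loops n (stack_diagram n A B) C =
    stack_loops n B C + stack_loops n A (stack_diagram n B C)"
proof -
  have "stack_loops n (stack_diagram n A B) C =
    card (inner_comps (lev_arcs 0 2 (stack_diagram n A B) \<union> lev_arcs 2 3 C)
      ({2} \<times> {1..n}) ((- {1, 2}) \<times> UNIV))"
    by (rule stack_loops_lev) auto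
  moreover have "stack_loops n A (stack_diagram n B C) =
    card (inner_comps (lev_arcs 0 1 A \<union> lev_arcs 1 3 (stack_diagram n B C))
      ({1} \<times> {1..n}) ((- {2, 1}) \<times> UNIV))"
    by (rule stack_loops_lev) auto
  ultimately show ?thesis
    using stack_contract_loops[of 0 1 2 A n B, OF _ ABC(1,2) lev_arcs_bounds(1), of 2]
      stack_contract_loops[of 1 2 3 B n C, OF _ ABC(2,3) lev_arcs_bounds(2), of 1]
    by (simp add: Un_ac insert_commute)
qed

end

subsection \<open>Linear structure\<close>

lemma lookup_tl_scale [simp]: "Poly_Mapping.lookup (tl_scale c x) D = c * Poly_Mapping.lookup x D"
  by (simp add: tl_scale_def Poly_Mapping.map.rep_eq when_def)

lemma lookup_tl_basis: "Poly_Mapping.lookup (tl_basis D) E = (if D = E then 1 else 0)"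
  by (simp add: tl_basis_def lookup_single when_def)

lemma keys_tl_basis [simp]: "Poly_Mapping.keys (tl_basis D) = {D}"
  by (simp add: tl_basis_def)

interpretation tl: module tl_scale
  by unfold_locales (auto intro!: poly_mapping_eqI simp: lookup_add algebra_simps)

interpretation tl_pair: module_pair tl_scale tl_scale ..

abbreviation tl_linear :: "(tl_elem \<Rightarrow> tl_elem) \<Rightarrow> bool" where
  "tl_linear \<equiv> module_hom tl_scale tl_scale"

lemma tl_linearI:
  assumes "\<And>x y. f (x + y) = f x + f y" "\<And>c x. f (tl_scale c x) = tl_scale c (f x)"
  shows "tl_linear f"
  by unfold_locales (rule assms)+

lemma tl_expand: "x = (\<Sum>D\<in>Poly_Mapping.keys x. tl_scale (Poly_Mapping.lookup x D) (tl_basis D))"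
proof (rule poly_mapping_eqI)
  fix E
  have "(\<Sum>D\<in>Poly_Mapping.keys x. Poly_Mapping.lookup x D * (if D = E then 1 else 0)) =
      Poly_Mapping.lookup x E"
    by (simp add: sum.delta in_keys_iff if_distrib cong: if_cong)
  then show "Poly_Mapping.lookup x E = Poly_Mapping.lookup
      (\<Sum>D\<in>Poly_Mapping.keys x. tl_scale (Poly_Mapping.lookup x D) (tl_basis D)) E"
    by (simp add: lookup_sum lookup_tl_basis)
qed

lemma span_tl_basis: "tl.span (tl_basis ` S) = {x. Poly_Mapping.keys x \<subseteq> S}"
proof (rule tl.span_subspace)
  show "tl.subspace {x. Poly_Mapping.keys x \<subseteq> S}"
  proof (rule tl.subspaceI)
    fix c and x y :: tl_elem assume "x \<in> {x. Poly_Mapping.keys x \<subseteq> S}" "y \<in> {x. Poly_Mapping.keys x \<subseteq> S}"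
    then show "x + y \<in> {x. Poly_Mapping.keys x \<subseteq> S}" "tl_scale c x \<in> {x. Poly_Mapping.keys x \<subseteq> S}"
      using keys_add[of x y] by (auto simp: in_keys_iff)
  qed simp
  show "{x. Poly_Mapping.keys x \<subseteq> S} \<subseteq> tl.span (tl_basis ` S)"
  proof
    fix x :: tl_elem assume "x \<in> {x. Poly_Mapping.keys x \<subseteq> S}"
    then have "(\<Sum>D\<in>Poly_Mapping.keys x. tl_scale (Poly_Mapping.lookup x D) (tl_basis D)) \<in> tl.span (tl_basis ` S)"
      by (intro tl.span_sum tl.span_scale tl.span_base) auto
    then show "x \<in> tl.span (tl_basis ` S)" by (simp flip: tl_expand)
  qed
qed auto

lemma subspace_TL: "tl.subspace (TL n)"
  unfolding TL_def span_tl_basis[symmetric] by simp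

text \<open>Reduces identities to basis diagrams. Only diagrams in the support of \<open>x\<close>
  have to be checked, so planarity of these can be drawn from \<open>x \<in> TL n\<close>.\<close>

lemma tl_linear_eqI:
  assumes "tl_linear f" "tl_linear g" "\<And>D. D \<in> Poly_Mapping.keys x \<Longrightarrow> f (tl_basis D) = g (tl_basis D)"
  shows "f x = g x"
proof (rule tl_pair.module_hom_eq_on_span[OF assms(1,2)])
  show "x \<in> tl.span (tl_basis ` Poly_Mapping.keys x)" by (simp add: span_tl_basis)
qed (use assms(3) in auto)

lemma tl_linear_id: "tl_linear (\<lambda>x. x)"
  by (rule tl_linearI) simp_all

lemma tl_linear_comp: "tl_linear f \<Longrightarrow> tl_linear g \<Longrightarrow> tl_linear (\<lambda>x. f (g x))"
  using module_hom_compose[of tl_scale tl_scale g tl_scale f] by (simp add: o_def)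

section \<open>Linear extension from diagrams and bilinearity of the product\<close>

definition lin_ext :: "(diagram \<Rightarrow> tl_elem) \<Rightarrow> tl_elem \<Rightarrow> tl_elem" where
  "lin_ext F x = (\<Sum>D\<in>Poly_Mapping.keys x. tl_scale (Poly_Mapping.lookup x D) (F D))"

text \<open>Supports shrink under cancellation, so sums over different supports are compared over a
  common finite set.\<close>

lemma lin_ext_superset:
  assumes "finite S" "Poly_Mapping.keys x \<subseteq> S"
  shows "lin_ext F x = (\<Sum>D\<in>S. tl_scale (Poly_Mapping.lookup x D) (F D))"
  unfolding lin_ext_def
  by (rule sum.mono_neutral_left[OF assms]) (simp add: in_keys_iff)

lemma tl_linear_lin_ext: "tl_linear (lin_ext F)"
proof (rule tl_linearI)
  fix c and x y :: tl_elem
  let ?S = "Poly_Mapping.keys x \<union> Poly_Mapping.keys y"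
  have "lin_ext F (x + y) = (\<Sum>D\<in>?S. tl_scale (Poly_Mapping.lookup (x + y) D) (F D))"
    by (rule lin_ext_superset) (use keys_add[of x y] in auto)
  moreover have "lin_ext F x = (\<Sum>D\<in>?S. tl_scale (Poly_Mapping.lookup x D) (F D))"
    "lin_ext F y = (\<Sum>D\<in>?S. tl_scale (Poly_Mapping.lookup y D) (F D))"
    by (rule lin_ext_superset; simp)+
  ultimately show "lin_ext F (x + y) = lin_ext F x + lin_ext F y"
    by (simp add: lookup_add tl.scale_left_distrib sum.distrib)
  have "lin_ext F (tl_scale c x) = (\<Sum>D\<in>?S. tl_scale (Poly_Mapping.lookup (tl_scale c x) D) (F D))"
    by (rule lin_ext_superset) (auto simp: in_keys_iff)
  then show "lin_ext F (tl_scale c x) = tl_scale c (lin_ext F x)"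
    by (simp add: lin_ext_superset[of ?S] tl.scale_sum_right)
qed

lemma lin_ext_basis [simp]: "lin_ext F (tl_basis D) = F D"
  by (simp add: lin_ext_def lookup_tl_basis)

definition stack_prod :: "nat \<Rightarrow> diagram \<Rightarrow> diagram \<Rightarrow> tl_elem" where
  "stack_prod n A B =
    tl_scale ((- qint 2) ^ stack_loops n A B) (tl_basis (stack_diagram n A B))"

text \<open>The double sum is read as a linear extension in the first factor here and, after
  exchanging the sums, in the second factor below; together this is bilinearity.\<close>

lemma tl_mult_lin_ext_left: "tl_mult n x y = lin_ext (\<lambda>A. lin_ext (stack_prod n A) y) x"
  by (simp add: tl_mult_def lin_ext_def stack_prod_def tl.scale_sum_right mult.assoc)

lemma tl_mult_lin_ext_right: "tl_mult n x y = lin_ext (\<lambda>B. lin_ext (\<lambda>A. stack_prod n A B) x) y"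
  unfolding tl_mult_def lin_ext_def
  by (subst sum.swap) (simp add: stack_prod_def tl.scale_sum_right mult_ac)

lemma tl_linear_mult_left: "tl_linear (\<lambda>x. tl_mult n x y)"
  unfolding tl_mult_lin_ext_left by (rule tl_linear_lin_ext)

lemma tl_linear_mult_right: "tl_linear (tl_mult n x)"
  unfolding tl_mult_lin_ext_right[abs_def] by (rule tl_linear_lin_ext)

lemma tl_mult_basis: "tl_mult n (tl_basis A) (tl_basis B) = stack_prod n A B"
  by (simp add: tl_mult_lin_ext_left)

lemmas tl_mult_scale_left = module_hom.scale[OF tl_linear_mult_left]
lemmas tl_mult_scale_right = module_hom.scale[OF tl_linear_mult_right]
lemmas tl_mult_sum_right = module_hom.sum[OF tl_linear_mult_right]
lemmas tl_mult_zero_left [simp] = module_hom.zero[OF tl_linear_mult_left]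
lemmas tl_mult_zero_right [simp] = module_hom.zero[OF tl_linear_mult_right]

lemma stack_prod_assoc:
  assumes "A \<subseteq> Pow (points n)" "B \<subseteq> Pow (points n)" "C \<subseteq> Pow (points n)"
  shows "tl_mult n (stack_prod n A B) (tl_basis C) = tl_mult n (tl_basis A) (stack_prod n B C)"
  by (simp add: stack_prod_def tl_mult_scale_left tl_mult_scale_right tl_mult_basis
      stack_diagram_assoc[OF assms] stack_loops_assoc[OF assms] flip: power_add)

lemma tl_mult_assoc:
  assumes "Poly_Mapping.keys x \<subseteq> Pow (Pow (points n))" "Poly_Mapping.keys y \<subseteq> Pow (Pow (points n))"
    "Poly_Mapping.keys z \<subseteq> Pow (Pow (points n))"
  shows "tl_mult n (tl_mult n x y) z = tl_mult n x (tl_mult n y z)"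
proof -
  have linear: "tl_linear (\<lambda>x. tl_mult n (tl_mult n x u) v)"
    "tl_linear (\<lambda>x. tl_mult n (tl_mult n u x) v)"
    "tl_linear (\<lambda>x. tl_mult n u (tl_mult n x v))"
    "tl_linear (\<lambda>x. tl_mult n u (tl_mult n v x))" for u v
    by (rule tl_linear_comp[OF tl_linear_mult_left tl_linear_mult_left]
        tl_linear_comp[OF tl_linear_mult_left tl_linear_mult_right]
        tl_linear_comp[OF tl_linear_mult_right tl_linear_mult_left]
        tl_linear_comp[OF tl_linear_mult_right tl_linear_mult_right])+
  show ?thesis
  proof (rule tl_linear_eqI[of "\<lambda>x. tl_mult n (tl_mult n x y) z"])
    fix A assume A: "A \<in> Poly_Mapping.keys x"
    show "tl_mult n (tl_mult n (tl_basis A) y) z = tl_mult n (tl_basis A) (tl_mult n y z)"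
    proof (rule tl_linear_eqI[of "\<lambda>y. tl_mult n (tl_mult n (tl_basis A) y) z"])
      fix B assume B: "B \<in> Poly_Mapping.keys y"
      show "tl_mult n (tl_mult n (tl_basis A) (tl_basis B)) z =
          tl_mult n (tl_basis A) (tl_mult n (tl_basis B) z)"
      proof (rule tl_linear_eqI[of "tl_mult n (tl_mult n (tl_basis A) (tl_basis B))"])
        fix C assume "C \<in> Poly_Mapping.keys z"
        with A B show "tl_mult n (tl_mult n (tl_basis A) (tl_basis B)) (tl_basis C) =
            tl_mult n (tl_basis A) (tl_mult n (tl_basis B) (tl_basis C))"
          unfolding tl_mult_basis using assms by (intro stack_prod_assoc) blast+
      qed (rule linear tl_linear_mult_right)+
    qed (rule linear)+
  qed (rule linear tl_linear_mult_left)+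
qed

subsection \<open>Perfect matchings\<close>

text \<open>A diagram stripped of planarity. Products with generators are computed at this level,
  and planarity of the result is checked afterwards.\<close>

definition perfect_matching :: "nat \<Rightarrow> diagram \<Rightarrow> bool" where
  "perfect_matching n D \<longleftrightarrow> partition_on (points n) D \<and> (\<forall>A\<in>D. card A = 2)"

lemma tl_diagrams_iff:
  "D \<in> tl_diagrams n \<longleftrightarrow> perfect_matching n D \<and> (\<forall>A\<in>D. \<forall>B\<in>D. \<not> crossing n A B)"
  by (simp add: tl_diagrams_def perfect_matching_def)

lemma perfect_matchingI:
  assumes "\<And>A. A \<in> D \<Longrightarrow> \<exists>x y. A = {x, y} \<and> x \<noteq> y \<and> x \<in> points n \<and> y \<in> points n"
    and "\<And>x. x \<in> points n \<Longrightarrow> \<exists>A\<in>D. x \<in> A"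
    and "\<And>A B x. A \<in> D \<Longrightarrow> B \<in> D \<Longrightarrow> x \<in> A \<Longrightarrow> x \<in> B \<Longrightarrow> A = B"
  shows "perfect_matching n D"
  unfolding perfect_matching_def
proof (intro conjI ballI partition_onI)
  show "\<Union>D = points n" using assms(1,2) by fast
  show "disjnt A B" if "A \<in> D" "B \<in> D" "A \<noteq> B" for A B
    using that assms(3) unfolding disjnt_def by blast
  show "{} \<notin> D" using assms(1) by blast
  show "card A = 2" if "A \<in> D" for A using assms(1)[OF that] by auto
qed

context
  fixes n D assumes D: "perfect_matching n D"
begin

lemma matching_arc_eq: "A \<in> D \<Longrightarrow> B \<in> D \<Longrightarrow> x \<in> A \<Longrightarrow> x \<in> B \<Longrightarrow> A = B"
  using D partition_onD2[of "points n" D] unfolding perfect_matching_def disjoint_def by blast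

lemma matching_arcE:
  assumes "A \<in> D"
  obtains x y where "A = {x, y}" "x \<noteq> y" "x \<in> points n" "y \<in> points n"
proof -
  have "card A = 2" "A \<subseteq> points n"
    using D assms unfolding perfect_matching_def partition_on_def by auto
  then show thesis using that by (auto simp: card_2_iff)
qed

lemma matching_arc_points: "{x, y} \<in> D \<Longrightarrow> x \<noteq> y \<and> x \<in> points n \<and> y \<in> points n"
  by (metis matching_arcE doubleton_eq_iff)

lemma matching_partner:
  assumes "x \<in> points n"
  obtains y where "{x, y} \<in> D"
proof -
  obtain A where "A \<in> D" "x \<in> A"
    using D assms unfolding perfect_matching_def partition_on_def by blast
  then show thesis using matching_arcE[of A] that by (metis insert_iff singletonD insert_commute)
qed

lemma matching_subset_Pow: "D \<subseteq> Pow (points n)"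
  using D unfolding perfect_matching_def partition_on_def by blast

lemma matching_subset_eq:
  assumes "D' \<subseteq> D" "perfect_matching n D'"
  shows "D' = D"
proof -
  have "A \<in> D'" if A: "A \<in> D" for A
  proof -
    obtain x y where x: "A = {x, y}" "x \<in> points n" using matching_arcE[OF A] by metis
    then obtain B where "B \<in> D'" "x \<in> B"
      using assms(2) unfolding perfect_matching_def partition_on_def by blast
    then show ?thesis using matching_arc_eq[of A B x] assms(1) A x by auto
  qed
  then show ?thesis using assms(1) by blast
qed

end

lemma inj_to_outer [simp]: "to_outer x = to_outer y \<longleftrightarrow> x = y"
  by (cases x; cases y) auto

lemma to_top_eq_outer: "to_top x = to_outer y \<longleftrightarrow> x = y \<and> x \<in> range Upper"
  by (cases x; cases y) auto

lemma inj_to_top [simp]: "to_top x = to_top y \<longleftrightarrow> x = y"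
  by (cases x; cases y) auto

lemma stack_point_eq_simps [simp]:
  "Mid j = to_top x \<longleftrightarrow> x = Lower j" "Bot j \<noteq> to_top x"
  "Mid j \<noteq> to_outer x" "Bot j = to_outer x \<longleftrightarrow> x = Lower j"
  by (cases x; auto)+

text \<open>
  Stacking on top of a diagram whose strands outside \<open>I\<close> are vertical covers both the identity
  and the generators.
\<close>

context
  fixes n :: nat and D B X :: diagram and I :: "nat set"
  assumes D: "perfect_matching n D" and X: "X \<subseteq> {Upper ` I, Lower ` I}"
    and B: "B = {{Upper j, Lower j} | j. j \<in> {1..n} - I} \<union> X"
begin

lemma stack_conn_pass:
  assumes "x \<in> points n" "x \<notin> Lower ` I"
  shows "(to_top x, to_outer x) \<in> stack_conn D B"
proof (cases x)
  case (Lower j)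
  then have "{Upper j, Lower j} \<in> B" using assms B by (auto simp: points_def)
  then have "to_bot ` {Upper j, Lower j} \<in> stack_arcs D B" unfolding stack_arcs_def by blast
  then show ?thesis unfolding stack_conn_eq using Lower by (auto intro: arc_conn_arc)
qed (simp add: stack_conn_eq)

lemma stack_conn_top:
  assumes "{x, y} \<in> D"
  shows "(to_top x, to_top y) \<in> stack_conn D B"
proof -
  have "to_top ` {x, y} \<in> stack_arcs D B" using assms unfolding stack_arcs_def by blast
  then show ?thesis unfolding stack_conn_eq by (auto intro: arc_conn_arc)
qed

lemma stack_conn_through:
  assumes "{x, y} \<in> D" "x \<notin> Lower ` I" "y \<notin> Lower ` I"
  shows "(to_outer x, to_outer y) \<in> stack_conn D B"
  using stack_conn_pass[of x] stack_conn_pass[of y] stack_conn_top[OF assms(1)] assms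
    matching_arc_points[OF D assms(1)] unfolding stack_conn_eq
  by (meson arc_conn_sym arc_conn_trans)

text \<open>A trap \<open>U\<close> for outer paths: a union of arcs of \<open>D\<close> containing
  all or none of the lower points in \<open>I\<close>, since the cup of \<open>B\<close> may connect
  these. The outer lower points of \<open>I\<close> are left out because they belong to the cap of
  \<open>B\<close>.\<close>

lemma stack_conn_closed:
  assumes U: "\<And>P. P \<in> D \<Longrightarrow> P \<inter> U \<noteq> {} \<Longrightarrow> P \<subseteq> U" "Lower ` I \<inter> U = {} \<or> Lower ` I \<subseteq> U"
    and x: "x \<in> U - Lower ` I" and xy: "(to_outer x, to_outer y) \<in> stack_conn D B"
  shows "y \<in> U - Lower ` I"
proof -
  \<comment> \<open>The first part contains the upper boundary points of \<open>U\<close> and its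
    middle points; the second adds the bottom ends of the vertical strands below them.\<close>
  let ?S = "to_top ` U \<union> to_outer ` (U - Lower ` I)"
  have Mid: "Mid j \<in> ?S \<longleftrightarrow> Lower j \<in> U" for j
    by (auto simp: image_iff)
  have Bot: "Bot j \<in> ?S \<longleftrightarrow> Lower j \<in> U - Lower ` I" for j
    by (auto simp: image_iff)
  have "to_outer y \<in> ?S"
    using xy unfolding stack_conn_eq
  proof (rule arc_conn_closed)
    show "to_outer x \<in> ?S" using x by blast
    fix E assume E: "E \<in> stack_arcs D B" "E \<inter> ?S \<noteq> {}"
    have "(\<exists>j. j \<notin> I \<and> to_bot ` Q = {Mid j, Bot j}) \<or> to_bot ` Q = Mid ` I \<or> to_bot ` Q = Bot ` I"
      if "Q \<in> B" for Q
      using that B subsetD[OF X, of Q] by (auto simp: image_image)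
    moreover have "E \<in> image to_top ` D \<union> image to_bot ` B"
      using E(1) unfolding stack_arcs_def .
    ultimately consider (top) P where "P \<in> D" "E = to_top ` P"
      | (vert) j where "j \<notin> I" "E = {Mid j, Bot j}"
      | (cup) "E = Mid ` I" | (cap) "E = Bot ` I"
      by (metis UnE imageE)
    then show "E \<subseteq> ?S"
    proof cases
      case top
      then have "P \<inter> U \<noteq> {}" using E(2) by (auto simp: to_top_eq_outer)
      then show ?thesis using U(1) top by blast
    next
      case vert
      then show ?thesis using E(2) Mid[of j] Bot[of j] by auto
    next
      case cup
      then show ?thesis using E(2) Mid U(2) by (auto simp del: Un_iff)
    next
      case cap
      then show ?thesis using E(2) Bot by (auto simp del: Un_iff)
    qed
  qed
  then show ?thesis by (auto simp: to_top_eq_outer[of _ y] eq_commute[of "to_outer y"])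
qed

end

subsection \<open>Stacking on a generator\<close>

lemma id_diagram_form: "id_diagram n = {{Upper j, Lower j} | j. j \<in> {1..n} - {}} \<union> {}"
  by (simp add: id_diagram_def)

lemma e_diagram_form:
  "e_diagram n i = {{Upper j, Lower j} | j. j \<in> {1..n} - {i, i + 1}} \<union>
    {Upper ` {i, i + 1}, Lower ` {i, i + 1}}"
  by (auto simp: e_diagram_def)

lemma e_diagram_to_bot:
  assumes "P \<in> e_diagram n i"
  shows "to_bot ` P = {Mid i, Mid (Suc i)} \<or> to_bot ` P = {Bot i, Bot (Suc i)} \<or>
    (\<exists>j. j \<noteq> i \<and> j \<noteq> Suc i \<and> to_bot ` P = {Mid j, Bot j})"
  using assms by (auto simp: e_diagram_def)

lemma stack_id_right:
  assumes D: "perfect_matching n D"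
  shows "stack_diagram n D (id_diagram n) = D"
proof (intro subset_antisym subsetI)
  fix A assume "A \<in> stack_diagram n D (id_diagram n)"
  then obtain x y where A: "A = {x, y}" "x \<in> points n" "x \<noteq> y"
      "(to_outer x, to_outer y) \<in> stack_conn D (id_diagram n)"
    unfolding stack_diagram_def by blast
  obtain z where z: "{x, z} \<in> D" using matching_partner[OF D] A(2) by blast
  have "y \<in> {x, z} - Lower ` {}"
  proof (rule stack_conn_closed[OF D _ id_diagram_form _ _ _ A(4)])
    show "P \<subseteq> {x, z}" if "P \<in> D" "P \<inter> {x, z} \<noteq> {}" for P
      using that z matching_arc_eq[OF D] by blast
  qed auto
  then show "A \<in> D" using A z by auto
next
  fix A assume A: "A \<in> D"
  then obtain x y where xy: "A = {x, y}" "x \<noteq> y" "x \<in> points n" "y \<in> points n"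
    using matching_arcE[OF D] by blast
  then have "(to_outer x, to_outer y) \<in> stack_conn D (id_diagram n)"
    using A by (intro stack_conn_through[OF D _ id_diagram_form]) auto
  then show "A \<in> stack_diagram n D (id_diagram n)" using xy by (simp add: stack_diagram_iff)
qed

lemma stack_loops_zeroI:
  assumes "\<And>j. j \<in> {1..n} \<Longrightarrow> \<exists>x. (Mid j, to_outer x) \<in> stack_conn A B"
  shows "stack_loops n A B = 0"
proof -
  have "{C. (\<exists>i\<in>{1..n}. C = stack_conn A B `` {Mid i}) \<and> C \<subseteq> range Mid} = {}"
  proof (rule ccontr)
    assume "\<not> ?thesis"
    then obtain j where "j \<in> {1..n}" "stack_conn A B `` {Mid j} \<subseteq> range Mid" by blast
    then obtain x where "to_outer x \<in> range Mid" using assms by blast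
    then show False by (cases x) auto
  qed
  then show ?thesis unfolding stack_loops_def by (simp only: card.empty)
qed

lemma stack_loops_id_right:
  assumes D: "perfect_matching n D"
  shows "stack_loops n D (id_diagram n) = 0"
proof (rule stack_loops_zeroI)
  fix j assume "j \<in> {1..n}"
  then show "\<exists>x. (Mid j, to_outer x) \<in> stack_conn D (id_diagram n)"
    using stack_conn_pass[OF D _ id_diagram_form, of "Lower j"]
    by (intro exI[of _ "Lower j"]) (auto simp: points_def)
qed

context
  fixes n i :: nat and D :: diagram
  assumes D: "perfect_matching n D" and i: "1 \<le> i" "i < n"
begin

lemmas e_pass = stack_conn_pass[OF D _ e_diagram_form]
lemmas e_through = stack_conn_through[OF D _ e_diagram_form]
lemmas e_closed = stack_conn_closed[OF D _ e_diagram_form]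

lemma lower_points: "Lower i \<in> points n" "Lower (Suc i) \<in> points n"
  using i by (auto simp: points_def)

lemma e_cup_conn: "(Mid i, Mid (Suc i)) \<in> stack_conn D (e_diagram n i)"
  and e_cap_conn: "(Bot i, Bot (Suc i)) \<in> stack_conn D (e_diagram n i)"
proof -
  have "to_bot ` {Upper i, Upper (i + 1)} \<in> stack_arcs D (e_diagram n i)"
    "to_bot ` {Lower i, Lower (i + 1)} \<in> stack_arcs D (e_diagram n i)"
    unfolding stack_arcs_def e_diagram_def by blast+
  then show "(Mid i, Mid (Suc i)) \<in> stack_conn D (e_diagram n i)"
    "(Bot i, Bot (Suc i)) \<in> stack_conn D (e_diagram n i)"
    unfolding stack_conn_eq by (auto intro: arc_conn_arc)
qed

lemma e_cap_closed:
  assumes "(Bot i, to_outer y) \<in> stack_conn D (e_diagram n i)"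
  shows "y \<in> {Lower i, Lower (Suc i)}"
proof -
  have "to_outer y \<in> {Bot i, Bot (Suc i)}"
    using assms unfolding stack_conn_eq
  proof (rule arc_conn_closed)
    fix E assume "E \<in> stack_arcs D (e_diagram n i)" "E \<inter> {Bot i, Bot (Suc i)} \<noteq> {}"
    moreover have "to_top ` P \<inter> {Bot i, Bot (Suc i)} = {}" for P by auto
    moreover have "to_bot ` P \<subseteq> {Bot i, Bot (Suc i)}"
      if "P \<in> e_diagram n i" "to_bot ` P \<inter> {Bot i, Bot (Suc i)} \<noteq> {}" for P
      using e_diagram_to_bot[OF that(1)] that(2) by (elim disjE exE conjE) simp_all
    moreover have "E \<in> image to_top ` D \<union> image to_bot ` e_diagram n i"
      using calculation(1) unfolding stack_arcs_def .
    ultimately show "E \<subseteq> {Bot i, Bot (Suc i)}" by (metis UnE imageE)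
  qed simp
  then show ?thesis by (cases y) auto
qed

text \<open>Bounds the product from above: every expected arc other than the new cap has to be the
  visible part of a trap \<open>U\<close>. The cap of the generator forms a component of its
  own.\<close>

lemma e_stack_subset:
  assumes N: "perfect_matching n N" "{Lower i, Lower (Suc i)} \<in> N"
    and U: "\<And>R x. R \<in> N \<Longrightarrow> R \<noteq> {Lower i, Lower (Suc i)} \<Longrightarrow>
      \<exists>U. (\<forall>P\<in>D. P \<inter> U \<noteq> {} \<longrightarrow> P \<subseteq> U) \<and>
        (Lower ` {i, i + 1} \<inter> U = {} \<or> Lower ` {i, i + 1} \<subseteq> U) \<and> U - Lower ` {i, i + 1} = R"
  shows "stack_diagram n D (e_diagram n i) \<subseteq> N"
proof
  fix A assume "A \<in> stack_diagram n D (e_diagram n i)"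
  then obtain x y where A: "A = {x, y}" "x \<in> points n" "x \<noteq> y"
      "(to_outer x, to_outer y) \<in> stack_conn D (e_diagram n i)"
    unfolding stack_diagram_def by blast
  obtain z where z: "{x, z} \<in> N" using matching_partner[OF N(1)] A(2) by blast
  have "y \<in> {x, z}"
  proof (cases "{x, z} = {Lower i, Lower (Suc i)}")
    case True
    then have "x = Lower i \<or> x = Lower (Suc i)" by (auto simp: doubleton_eq_iff)
    then have "(Bot i, to_outer x) \<in> stack_conn D (e_diagram n i)"
      using e_cap_conn unfolding stack_conn_eq by auto
    then have "(Bot i, to_outer y) \<in> stack_conn D (e_diagram n i)"
      using A(4) unfolding stack_conn_eq by (rule arc_conn_trans)
    then show ?thesis using e_cap_closed True by blast
  next
    case False
    obtain U where U: "\<forall>P\<in>D. P \<inter> U \<noteq> {} \<longrightarrow> P \<subseteq> U"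
        "Lower ` {i, i + 1} \<inter> U = {} \<or> Lower ` {i, i + 1} \<subseteq> U" "U - Lower ` {i, i + 1} = {x, z}"
      using U[OF z False] by (elim exE conjE) (rule that)
    have "y \<in> U - Lower ` {i, i + 1}"
    proof (rule e_closed[OF _ _ _ _ A(4)])
      show "x \<in> U - Lower ` {i, i + 1}" unfolding U(3) by simp
    qed (use U(1,2) in simp_all)
    then show ?thesis using U(3) by blast
  qed
  then show "A \<in> N" using A z by auto
qed

text \<open>A cap of \<open>D\<close> meeting the cup of the generator closes one loop, and the cap
  of the generator takes the place of the lost one. This is the source of the factor -[2].\<close>

lemma stack_e_cap:
  assumes "{Lower i, Lower (Suc i)} \<in> D"
  shows "stack_diagram n D (e_diagram n i) = D" "stack_loops n D (e_diagram n i) = 1"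
proof -
  let ?c = "stack_conn D (e_diagram n i)"
  have other: "Lower i \<notin> A \<and> Lower (Suc i) \<notin> A" if "A \<in> D" "A \<noteq> {Lower i, Lower (Suc i)}" for A
    using matching_arc_eq[OF D that(1) assms] that by blast
  show "stack_diagram n D (e_diagram n i) = D"
  proof
    show "stack_diagram n D (e_diagram n i) \<subseteq> D"
    proof (rule e_stack_subset[OF D assms])
      fix R assume R: "R \<in> D" "R \<noteq> {Lower i, Lower (Suc i)}"
      then show "\<exists>U. (\<forall>P\<in>D. P \<inter> U \<noteq> {} \<longrightarrow> P \<subseteq> U) \<and>
          (Lower ` {i, i + 1} \<inter> U = {} \<or> Lower ` {i, i + 1} \<subseteq> U) \<and> U - Lower ` {i, i + 1} = R"
        using other[OF R] matching_arc_eq[OF D _ R(1)] by (intro exI[of _ R]) auto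
    qed
    show "D \<subseteq> stack_diagram n D (e_diagram n i)"
    proof
      fix A assume A: "A \<in> D"
      obtain x y where xy: "A = {x, y}" "x \<noteq> y" "x \<in> points n" "y \<in> points n"
        using matching_arcE[OF D A] by blast
      show "A \<in> stack_diagram n D (e_diagram n i)"
      proof (cases "A = {Lower i, Lower (Suc i)}")
        case True
        then show ?thesis using e_cap_conn lower_points by (simp add: stack_diagram_iff)
      next
        case False
        then have "(to_outer x, to_outer y) \<in> ?c"
          using A other[OF A] xy by (intro e_through) auto
        then show ?thesis using xy by (simp add: stack_diagram_iff)
      qed
    qed
  qed
  have closed: "v \<in> {Mid i, Mid (Suc i)}" if "(u, v) \<in> ?c" "u \<in> {Mid i, Mid (Suc i)}" for u v
    using that(1) unfolding stack_conn_eq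
  proof (rule arc_conn_closed)
    fix E assume E: "E \<in> stack_arcs D (e_diagram n i)" "E \<inter> {Mid i, Mid (Suc i)} \<noteq> {}"
    have "E \<subseteq> {Mid i, Mid (Suc i)}" if "E = to_top ` P" "P \<in> D" for P
    proof -
      have "Lower i \<in> P \<or> Lower (Suc i) \<in> P" using E(2) that by auto
      then have "P = {Lower i, Lower (Suc i)}" using other[OF that(2)] by blast
      then show ?thesis using that by auto
    qed
    moreover have "E \<subseteq> {Mid i, Mid (Suc i)}" if "E = to_bot ` P" "P \<in> e_diagram n i" for P
      using e_diagram_to_bot[OF that(2)] E(2) that(1) by (elim disjE exE conjE) simp_all
    moreover have "E \<in> image to_top ` D \<union> image to_bot ` e_diagram n i"
      using E(1) unfolding stack_arcs_def .
    ultimately show "E \<subseteq> {Mid i, Mid (Suc i)}" by (metis UnE imageE)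
  qed (use that in auto)
  have comp: "?c `` {Mid j} = {Mid i, Mid (Suc i)}" if "j = i \<or> j = Suc i" for j
    using closed[of "Mid j"] that e_cup_conn unfolding stack_conn_eq
    by (auto intro: arc_conn_sym)
  have "{C. (\<exists>j\<in>{1..n}. C = ?c `` {Mid j}) \<and> C \<subseteq> range Mid} = {{Mid i, Mid (Suc i)}}"
  proof (intro subset_antisym subsetI)
    fix C assume "C \<in> {C. (\<exists>j\<in>{1..n}. C = ?c `` {Mid j}) \<and> C \<subseteq> range Mid}"
    then obtain j where j: "j \<in> {1..n}" "C = ?c `` {Mid j}" "C \<subseteq> range Mid" by blast
    \<comment> \<open>Below any other middle point the generator has a vertical strand leading to
      the boundary.\<close>
    have "j = i \<or> j = Suc i"
    proof (rule ccontr)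
      assume "\<not> ?thesis"
      then have "(Mid j, Bot j) \<in> ?c"
        using e_pass[where x = "Lower j"] j by (auto simp: points_def)
      then show False using j by blast
    qed
    then show "C \<in> {{Mid i, Mid (Suc i)}}" using j comp by simp
  next
    fix C assume "C \<in> {{Mid i, Mid (Suc i)}}"
    then show "C \<in> {C. (\<exists>j\<in>{1..n}. C = ?c `` {Mid j}) \<and> C \<subseteq> range Mid}"
      using comp[of i] i by (intro CollectI conjI bexI[of _ i]) auto
  qed
  then show "stack_loops n D (e_diagram n i) = 1" unfolding stack_loops_def by simp
qed

text \<open>The product with the generator when \<open>Lower i\<close> and
  \<open>Lower (Suc i)\<close> have the distinct partners \<open>p\<close> and \<open>p'\<close>:
  the cup links the two strands into one arc, and the cap of the generator is added.\<close>

definition cap_join :: "point \<Rightarrow> point \<Rightarrow> diagram" where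
  "cap_join p p' = D - {{Lower i, p}, {Lower (Suc i), p'}} \<union> {{p, p'}, {Lower i, Lower (Suc i)}}"

context
  fixes p p' assumes p: "{Lower i, p} \<in> D" "{Lower (Suc i), p'} \<in> D" "p \<noteq> Lower (Suc i)"
begin

lemma cap_join_distinct:
  "distinct [Lower i, Lower (Suc i), p, p']" "p \<in> points n" "p' \<in> points n"
  using p matching_arc_points[OF D p(1)] matching_arc_points[OF D p(2)]
    matching_arc_eq[OF D p(1,2)] by (auto simp: doubleton_eq_iff)

lemma cap_join_other:
  assumes "A \<in> D" "A \<noteq> {Lower i, p}" "A \<noteq> {Lower (Suc i), p'}"
  shows "Lower i \<notin> A" "Lower (Suc i) \<notin> A" "p \<notin> A" "p' \<notin> A"
  using matching_arc_eq[OF D assms(1) p(1)] matching_arc_eq[OF D assms(1) p(2)] assms by blast+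

lemma perfect_matching_join: "perfect_matching n (cap_join p p')"
proof (rule perfect_matchingI)
  fix A assume "A \<in> cap_join p p'"
  then consider "A \<in> D" | "A = {p, p'}" | "A = {Lower i, Lower (Suc i)}" unfolding cap_join_def by blast
  then show "\<exists>x y. A = {x, y} \<and> x \<noteq> y \<and> x \<in> points n \<and> y \<in> points n"
  proof cases
    case 1
    then show ?thesis by (rule matching_arcE[OF D]) blast
  next
    case 2
    then show ?thesis using cap_join_distinct by (intro exI[of _ p] exI[of _ p']) simp
  next
    case 3
    then show ?thesis using lower_points by (intro exI[of _ "Lower i"] exI[of _ "Lower (Suc i)"]) simp
  qed
next
  fix x assume "x \<in> points n"
  then obtain y where y: "{x, y} \<in> D" using matching_partner[OF D] by blast
  consider "x \<in> {p, p'}" | "x \<in> {Lower i, Lower (Suc i)}"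
    | "x \<notin> {p, p'}" "x \<notin> {Lower i, Lower (Suc i)}" by blast
  then show "\<exists>A\<in>cap_join p p'. x \<in> A"
  proof cases
    case 1
    then show ?thesis by (intro bexI[of _ "{p, p'}"]) (auto simp: cap_join_def)
  next
    case 2
    then show ?thesis by (intro bexI[of _ "{Lower i, Lower (Suc i)}"]) (auto simp: cap_join_def)
  next
    case 3
    then show ?thesis using y
      by (intro bexI[of _ "{x, y}"]) (auto simp: cap_join_def doubleton_eq_iff)
  qed
next
  have cases: "A = {p, p'} \<or> A = {Lower i, Lower (Suc i)} \<or>
      A \<in> D \<and> Lower i \<notin> A \<and> Lower (Suc i) \<notin> A \<and> p \<notin> A \<and> p' \<notin> A" if "A \<in> cap_join p p'" for A
  proof (cases "A = {p, p'} \<or> A = {Lower i, Lower (Suc i)}")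
    case False
    then have "A \<in> D" "A \<noteq> {Lower i, p}" "A \<noteq> {Lower (Suc i), p'}"
      using that by (simp_all add: cap_join_def)
    then show ?thesis using cap_join_other[of A] by simp
  qed blast
  fix A B x assume AB: "A \<in> cap_join p p'" "B \<in> cap_join p p'" "x \<in> A" "x \<in> B"
  have pp: "C = {p, p'}" if "C \<in> cap_join p p'" "x \<in> C" "x \<in> {p, p'}" for C
    using cases[OF that(1)] that(2,3) cap_join_distinct(1) by (elim disjE) auto
  have ll: "C = {Lower i, Lower (Suc i)}"
    if "C \<in> cap_join p p'" "x \<in> C" "x \<in> {Lower i, Lower (Suc i)}" for C
    using cases[OF that(1)] that(2,3) cap_join_distinct(1) by (elim disjE) auto
  have "A \<in> D" "B \<in> D" if "x \<notin> {p, p'}" "x \<notin> {Lower i, Lower (Suc i)}"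
    using cases[OF AB(1)] cases[OF AB(2)] AB(3,4) that by auto
  then show "A = B"
    using pp[OF AB(1,3)] pp[OF AB(2,4)] ll[OF AB(1,3)] ll[OF AB(2,4)] matching_arc_eq[OF D _ _ AB(3,4)]
    by (cases "x \<in> {p, p'}"; cases "x \<in> {Lower i, Lower (Suc i)}") simp_all
qed

lemma stack_e_join: "stack_diagram n D (e_diagram n i) = cap_join p p'"
proof
  show "stack_diagram n D (e_diagram n i) \<subseteq> cap_join p p'"
  proof (rule e_stack_subset[OF perfect_matching_join])
    show "{Lower i, Lower (Suc i)} \<in> cap_join p p'" by (simp add: cap_join_def)
    fix R assume R: "R \<in> cap_join p p'" "R \<noteq> {Lower i, Lower (Suc i)}"
    \<comment> \<open>The two old arcs that the cup glues together; only their far ends remain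
      visible.\<close>
    let ?U = "{Lower i, p, Lower (Suc i), p'}"
    have "P \<subseteq> ?U" if "P \<in> D" "P \<inter> ?U \<noteq> {}" for P
      using cap_join_other[OF that(1)] that(2) by blast
    moreover have "?U - Lower ` {i, i + 1} = {p, p'}" using cap_join_distinct by auto
    ultimately have "\<exists>U. (\<forall>P\<in>D. P \<inter> U \<noteq> {} \<longrightarrow> P \<subseteq> U) \<and>
        (Lower ` {i, i + 1} \<inter> U = {} \<or> Lower ` {i, i + 1} \<subseteq> U) \<and> U - Lower ` {i, i + 1} = {p, p'}"
      by (intro exI[of _ ?U]) auto
    moreover have "\<exists>U. (\<forall>P\<in>D. P \<inter> U \<noteq> {} \<longrightarrow> P \<subseteq> U) \<and>
        (Lower ` {i, i + 1} \<inter> U = {} \<or> Lower ` {i, i + 1} \<subseteq> U) \<and> U - Lower ` {i, i + 1} = R"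
      if "R \<noteq> {p, p'}"
    proof -
      have R': "R \<in> D" "R \<noteq> {Lower i, p}" "R \<noteq> {Lower (Suc i), p'}"
        using R that unfolding cap_join_def by auto
      then show ?thesis
        using cap_join_other[OF R'] matching_arc_eq[OF D _ R'(1)] by (intro exI[of _ R]) auto
    qed
    ultimately show "\<exists>U. (\<forall>P\<in>D. P \<inter> U \<noteq> {} \<longrightarrow> P \<subseteq> U) \<and>
        (Lower ` {i, i + 1} \<inter> U = {} \<or> Lower ` {i, i + 1} \<subseteq> U) \<and> U - Lower ` {i, i + 1} = R"
      by blast
  qed
  show "cap_join p p' \<subseteq> stack_diagram n D (e_diagram n i)"
  proof
    fix A assume A: "A \<in> cap_join p p'"
    consider "A = {Lower i, Lower (Suc i)}" | "A = {p, p'}"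
      | "A \<in> D" "A \<noteq> {Lower i, p}" "A \<noteq> {Lower (Suc i), p'}"
      using A unfolding cap_join_def by blast
    then show "A \<in> stack_diagram n D (e_diagram n i)"
    proof cases
      case 1
      then show ?thesis using e_cap_conn lower_points by (simp add: stack_diagram_iff)
    next
      case 2
      \<comment> \<open>The connecting path runs from \<open>p\<close> along its old arc to
        \<open>Mid i\<close>, through the cup to \<open>Mid (Suc i)\<close>, and along the other old
        arc to \<open>p'\<close>.\<close>
      have "(to_outer p, to_top p) \<in> stack_conn D (e_diagram n i)"
        "(to_top p', to_outer p') \<in> stack_conn D (e_diagram n i)"
        using e_pass[where x = p] e_pass[where x = p'] cap_join_distinct unfolding stack_conn_eq
        by (auto intro: arc_conn_sym)
      moreover have "(to_top p, Mid i) \<in> stack_conn D (e_diagram n i)"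
        "(Mid (Suc i), to_top p') \<in> stack_conn D (e_diagram n i)"
        using stack_conn_top[OF D _ e_diagram_form p(1)] stack_conn_top[OF D _ e_diagram_form p(2)]
        unfolding stack_conn_eq by (auto intro: arc_conn_sym)
      ultimately have "(to_outer p, to_outer p') \<in> stack_conn D (e_diagram n i)"
        using e_cup_conn unfolding stack_conn_eq by (meson arc_conn_trans)
      then show ?thesis using 2 cap_join_distinct by (simp add: stack_diagram_iff)
    next
      case 3
      obtain x y where xy: "A = {x, y}" "x \<noteq> y" "x \<in> points n" "y \<in> points n"
        using matching_arcE[OF D 3(1)] by blast
      then have "(to_outer x, to_outer y) \<in> stack_conn D (e_diagram n i)"
        using 3 cap_join_other[OF 3] by (intro e_through) auto
      then show ?thesis using xy by (simp add: stack_diagram_iff)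
    qed
  qed
qed

text \<open>Every middle point reaches the boundary: the two under the cup through \<open>p\<close>
  and \<open>p'\<close>, any other straight down.\<close>

lemma stack_loops_join: "stack_loops n D (e_diagram n i) = 0"
proof (rule stack_loops_zeroI)
  fix j assume j: "j \<in> {1..n}"
  have "(Mid j, to_outer q) \<in> stack_conn D (e_diagram n i)"
    if "{Lower j, q} \<in> D" "q \<notin> Lower ` {i, i + 1}" for q
  proof -
    have "(Mid j, to_top q) \<in> stack_conn D (e_diagram n i)"
      using stack_conn_top[OF D _ e_diagram_form that(1)] by simp
    moreover have "(to_top q, to_outer q) \<in> stack_conn D (e_diagram n i)"
      using that matching_arc_points[OF D that(1)] by (intro e_pass) auto
    ultimately show ?thesis unfolding stack_conn_eq by (rule arc_conn_trans)
  qed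
  note arc = this
  consider "j = i" | "j = Suc i" | "j \<noteq> i" "j \<noteq> Suc i" by blast
  then show "\<exists>x. (Mid j, to_outer x) \<in> stack_conn D (e_diagram n i)"
  proof cases
    case 1
    then show ?thesis using arc[of p] p cap_join_distinct by auto
  next
    case 2
    then show ?thesis using arc[of p'] p cap_join_distinct by auto
  next
    case 3
    then show ?thesis
      using e_pass[where x = "Lower j"] j by (intro exI[of _ "Lower j"]) (auto simp: points_def)
  qed
qed

end
end

subsection \<open>Planarity\<close>

lemma bpos_inj: "x \<in> points n \<Longrightarrow> y \<in> points n \<Longrightarrow> bpos n x = bpos n y \<longleftrightarrow> x = y"
  by (cases x; cases y) (auto simp: points_def)

lemma tl_diagramsI:
  assumes "perfect_matching n D"
    and "\<And>a b c d. {a, b} \<in> D \<Longrightarrow> {c, d} \<in> D \<Longrightarrow>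
      bpos n a < bpos n c \<Longrightarrow> bpos n c < bpos n b \<Longrightarrow> bpos n b < bpos n d \<Longrightarrow> False"
  shows "D \<in> tl_diagrams n"
  unfolding tl_diagrams_iff crossing_def using assms by blast

lemma tl_matching: "D \<in> tl_diagrams n \<Longrightarrow> perfect_matching n D"
  by (simp add: tl_diagrams_iff)

lemma tl_noncrossing:
  assumes "D \<in> tl_diagrams n" "{a, b} \<in> D" "{c, d} \<in> D"
  shows "\<not> (bpos n a < bpos n c \<and> bpos n c < bpos n b \<and> bpos n b < bpos n d)"
  using assms unfolding tl_diagrams_iff crossing_def by blast

context
  fixes n i :: nat and D :: diagram
  assumes D: "D \<in> tl_diagrams n" and i: "1 \<le> i" "i < n"
begin

text \<open>The glued points \<open>u\<close>, \<open>v\<close> are adjacent on the boundary, so an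
  arc \<open>{a, b}\<close> has both on the same side. If it separates \<open>p\<close> from
  \<open>q\<close>, it therefore crosses one of the old arcs \<open>{u, p}\<close>,
  \<open>{v, q}\<close>. The order of \<open>u\<close> and \<open>v\<close> is left open so that
  both orientations are covered.\<close>

lemma cap_join_noncrossing_aux:
  assumes uv: "{u, v} = {Lower i, Lower (Suc i)}"
    and arcs: "{u, p} \<in> D" "{v, q} \<in> D" and ab: "{a, b} \<in> D"
    and notin: "a \<notin> {u, v, p, q}" "b \<notin> {u, v, p, q}" and ne: "p \<noteq> v"
  shows "\<not> (bpos n p < bpos n a \<and> bpos n a < bpos n q \<and> bpos n q < bpos n b)"
    and "\<not> (bpos n a < bpos n p \<and> bpos n p < bpos n b \<and> bpos n b < bpos n q)"
proof -
  have pts: "u \<in> points n" "v \<in> points n" "p \<in> points n" "q \<in> points n" "a \<in> points n" "b \<in> points n"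
    using matching_arc_points[OF tl_matching[OF D]] arcs ab by blast+
  have "p \<noteq> u" "q \<noteq> v" "q \<noteq> u"
    using matching_arc_points[OF tl_matching[OF D] arcs(1)] matching_arc_points[OF tl_matching[OF D] arcs(2)]
      matching_arc_eq[OF tl_matching[OF D] arcs(1,2), of u] ne by (auto simp: doubleton_eq_iff)
  then have dist: "bpos n x \<noteq> bpos n y" if "x \<in> {u, v}" "y \<in> {p, q, a, b}" for x y
    using that notin ne pts by (subst bpos_inj) auto
  have consec: "bpos n u = Suc (bpos n v) \<or> bpos n v = Suc (bpos n u)"
    using uv i by (auto simp: doubleton_eq_iff)
  note nc = tl_noncrossing[OF D]
  have d: "bpos n u \<noteq> bpos n p" "bpos n u \<noteq> bpos n q" "bpos n u \<noteq> bpos n a" "bpos n u \<noteq> bpos n b"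
    "bpos n v \<noteq> bpos n p" "bpos n v \<noteq> bpos n q" "bpos n v \<noteq> bpos n a" "bpos n v \<noteq> bpos n b"
    using dist by simp_all
  have arcs': "{p, u} \<in> D" "{q, v} \<in> D" using arcs by (simp_all add: insert_commute)
  show "\<not> (bpos n p < bpos n a \<and> bpos n a < bpos n q \<and> bpos n q < bpos n b)"
    using nc[OF arcs(2) ab] nc[OF ab arcs'(2)] nc[OF arcs'(1) ab] consec d by linarith
  show "\<not> (bpos n a < bpos n p \<and> bpos n p < bpos n b \<and> bpos n b < bpos n q)"
    using nc[OF ab arcs'(1)] nc[OF ab arcs(2)] nc[OF arcs(1) ab] consec d by linarith
qed

lemma stack_e_planar: "stack_diagram n D (e_diagram n i) \<in> tl_diagrams n"
proof -
  note M = tl_matching[OF D]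
  obtain p where p: "{Lower i, p} \<in> D" by (rule matching_partner[OF M lower_points(1)[OF M i]])
  obtain p' where p': "{Lower (Suc i), p'} \<in> D"
    by (rule matching_partner[OF M lower_points(2)[OF M i]])
  show ?thesis
  proof (cases "p = Lower (Suc i)")
    case True
    then show ?thesis using stack_e_cap[OF M i] p D by simp
  next
    case False
    note cap_join = cap_join_distinct[OF M i p p' False] cap_join_other[OF M i p p' False]
    have "cap_join i D p p' \<in> tl_diagrams n"
    proof (rule tl_diagramsI)
      show "perfect_matching n (cap_join i D p p')" by (rule perfect_matching_join[OF M i p p' False])
      fix a b c d
      assume ab: "{a, b} \<in> cap_join i D p p'" and cd: "{c, d} \<in> cap_join i D p p'"
        and ord: "bpos n a < bpos n c" "bpos n c < bpos n b" "bpos n b < bpos n d"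
      have cases: "{x, y} = {p, p'} \<or> {x, y} = {Lower i, Lower (Suc i)} \<or> {x, y} \<in> D \<and>
          x \<notin> {Lower i, Lower (Suc i), p, p'} \<and> y \<notin> {Lower i, Lower (Suc i), p, p'}"
        if "{x, y} \<in> cap_join i D p p'" for x y
      proof (cases "{x, y} = {p, p'} \<or> {x, y} = {Lower i, Lower (Suc i)}")
        case False
        then have "{x, y} \<in> D" "{x, y} \<noteq> {Lower i, p}" "{x, y} \<noteq> {Lower (Suc i), p'}"
          using that by (simp_all add: cap_join_def[OF M i])
        then show ?thesis using cap_join(4-)[of "{x, y}"] by auto
      qed blast
      \<comment> \<open>The ends of the new cap occupy neighbouring positions, so no end point fits
        between them; only the arc \<open>{p, p'}\<close> can cause a crossing.\<close>
      have caps: "{a, b} \<noteq> {Lower i, Lower (Suc i)}" "{c, d} \<noteq> {Lower i, Lower (Suc i)}"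
        using ord i by (auto simp: doubleton_eq_iff)
      have same: False if "{a, b} = {p, p'}" "{c, d} = {p, p'}"
        using ord that by (auto simp: doubleton_eq_iff)
      have old: False if "{a, b} \<in> D" "{c, d} \<in> D"
        using tl_noncrossing[OF D that] ord by simp
      have first: False
        if A: "{a, b} = {p, p'}" and B: "{c, d} \<in> D" "c \<notin> {Lower i, Lower (Suc i), p, p'}"
          "d \<notin> {Lower i, Lower (Suc i), p, p'}"
      proof -
        consider "a = p" "b = p'" | "a = p'" "b = p" using A by (auto simp: doubleton_eq_iff)
        then show False
          using cap_join_noncrossing_aux(1)[OF refl p p' B(1)] cap_join(1) ord B False
            cap_join_noncrossing_aux(1)[of "Lower (Suc i)" "Lower i", OF insert_commute p' p B(1)]
          by cases auto
      qed
      have second: False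
        if A: "{c, d} = {p, p'}" and B: "{a, b} \<in> D" "a \<notin> {Lower i, Lower (Suc i), p, p'}"
          "b \<notin> {Lower i, Lower (Suc i), p, p'}"
      proof -
        consider "c = p" "d = p'" | "c = p'" "d = p" using A by (auto simp: doubleton_eq_iff)
        then show False
          using cap_join_noncrossing_aux(2)[OF refl p p' B(1)] cap_join(1) ord B False
            cap_join_noncrossing_aux(2)[of "Lower (Suc i)" "Lower i", OF insert_commute p' p B(1)]
          by cases auto
      qed
      from cases[OF ab] caps(1) consider "{a, b} = {p, p'}"
        | "{a, b} \<in> D" "a \<notin> {Lower i, Lower (Suc i), p, p'}" "b \<notin> {Lower i, Lower (Suc i), p, p'}"
        by (elim disjE conjE) simp_all
      note ab_cases = this
      from cases[OF cd] caps(2) consider "{c, d} = {p, p'}"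
        | "{c, d} \<in> D" "c \<notin> {Lower i, Lower (Suc i), p, p'}" "d \<notin> {Lower i, Lower (Suc i), p, p'}"
        by (elim disjE conjE) simp_all
      note cd_cases = this
      show False
      proof (rule ab_cases)
        assume A: "{a, b} = {p, p'}"
        show False by (rule cd_cases, rule same[OF A], assumption, rule first[OF A], assumption+)
      next
        assume A: "{a, b} \<in> D" "a \<notin> {Lower i, Lower (Suc i), p, p'}"
          "b \<notin> {Lower i, Lower (Suc i), p, p'}"
        show False by (rule cd_cases, rule second[OF _ A], assumption, rule old[OF A(1)], assumption+)
      qed
    qed
    then show ?thesis using stack_e_join[OF M i p p' False] by simp
  qed
qed

end

lemma matching_id: "perfect_matching n (id_diagram n)"
proof (rule perfect_matchingI)
  fix x assume "x \<in> points n"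
  then obtain j where j: "j \<in> {1..n}" "x = Upper j \<or> x = Lower j" by (auto simp: points_def)
  then have "{Upper j, Lower j} \<in> id_diagram n" by (auto simp: id_diagram_def)
  then show "\<exists>A\<in>id_diagram n. x \<in> A" using j by blast
next
  fix A assume "A \<in> id_diagram n"
  then obtain j where "A = {Upper j, Lower j}" "Upper j \<in> points n" "Lower j \<in> points n"
    by (auto simp: id_diagram_def points_def)
  then show "\<exists>x y. A = {x, y} \<and> x \<noteq> y \<and> x \<in> points n \<and> y \<in> points n" by blast
qed (auto simp: id_diagram_def)

lemma id_planar: "id_diagram n \<in> tl_diagrams n"
proof (rule tl_diagramsI[OF matching_id])
  fix a b c d assume "{a, b} \<in> id_diagram n" "{c, d} \<in> id_diagram n"
    and ord: "bpos n a < bpos n c" "bpos n c < bpos n b" "bpos n b < bpos n d"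
  then obtain j k where "j \<in> {1..n}" "k \<in> {1..n}" "{a, b} = {Upper j, Lower j}" "{c, d} = {Upper k, Lower k}"
    unfolding id_diagram_def by blast
  then show False using ord by (auto simp: doubleton_eq_iff)
qed

text \<open>An innermost arc on the upper edge is short; without such arcs the strands are increasing.\<close>

lemma planar_short_cup:
  assumes D: "D \<in> tl_diagrams n" and ab: "{Upper a, Upper b} \<in> D" "a < b"
  shows "\<exists>k. 1 \<le> k \<and> k < n \<and> {Upper k, Upper (Suc k)} \<in> D"
  using ab
proof (induction "b - a" arbitrary: a b rule: less_induct)
  case less
  note M = tl_matching[OF D]
  have pts: "1 \<le> a" "a \<le> n" "1 \<le> b" "b \<le> n"
    using matching_arc_points[OF M less.prems(1)] by (auto simp: points_def)
  show ?case
  proof (cases "b = Suc a")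
    case True
    then show ?thesis using less.prems pts by auto
  next
    case False
    \<comment> \<open>The partner of the point next to \<open>a\<close> is confined below the arc
      \<open>{Upper a, Upper b}\<close>, which yields a shorter nested arc.\<close>
    then have "Upper (Suc a) \<in> points n" using less.prems pts by (auto simp: points_def)
    then obtain x where x: "{Upper (Suc a), x} \<in> D" using matching_partner[OF M] by blast
    then have x': "{x, Upper (Suc a)} \<in> D" by (simp add: insert_commute)
    have "x \<in> points n" "x \<noteq> Upper (Suc a)" using matching_arc_points[OF M x] by auto
    moreover have "x \<noteq> Upper a" "x \<noteq> Upper b"
      using matching_arc_eq[OF M x less.prems(1)] False by (auto simp: doubleton_eq_iff)
    ultimately have "bpos n x \<noteq> a" "bpos n x \<noteq> b" "bpos n x \<noteq> Suc a"
      using bpos_inj[of x n "Upper a"] bpos_inj[of x n "Upper b"] bpos_inj[of x n "Upper (Suc a)"] pts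
        less.prems False by (auto simp: points_def)
    then have between: "Suc a < bpos n x" "bpos n x < b"
      using tl_noncrossing[OF D less.prems(1) x] tl_noncrossing[OF D x' less.prems(1)]
        less.prems(2) False by simp_all
    then obtain c where "x = Upper c" using \<open>x \<in> points n\<close> pts by (cases x) (auto simp: points_def)
    then show ?thesis using less.hyps[of c "Suc a"] between x by auto
  qed
qed

lemma planar_no_cup:
  assumes D: "D \<in> tl_diagrams n" and "\<And>a b. {Upper a, Upper b} \<notin> D"
  shows "D = id_diagram n"
proof -
  note M = tl_matching[OF D]
  have "\<exists>b. b \<in> {1..n} \<and> {Upper a, Lower b} \<in> D" if "a \<in> {1..n}" for a
  proof -
    have "Upper a \<in> points n" using that by (simp add: points_def)
    then obtain x where x: "{Upper a, x} \<in> D" using matching_partner[OF M] by blast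
    then show ?thesis using matching_arc_points[OF M x] assms(2) by (cases x) (auto simp: points_def)
  qed
  then obtain s where s: "\<And>a. a \<in> {1..n} \<Longrightarrow> s a \<in> {1..n} \<and> {Upper a, Lower (s a)} \<in> D" by metis
  \<comment> \<open>The lower edge is traversed from right to left, so an inversion of the strands
    becomes an interleaving of end points.\<close>
  have mono: "s a < s b" if "a \<in> {1..n}" "b \<in> {1..n}" "a < b" for a b
  proof (rule ccontr)
    assume "\<not> s a < s b"
    moreover have "s a \<noteq> s b"
      using matching_arc_eq[OF M, of "{Upper a, Lower (s a)}" "{Upper b, Lower (s b)}" "Lower (s a)"]
        s[OF that(1)] s[OF that(2)] that by (auto simp: doubleton_eq_iff)
    ultimately show False
      using tl_noncrossing[OF D, of "Upper a" "Lower (s a)" "Upper b" "Lower (s b)"]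
        s[OF that(1)] s[OF that(2)] that by auto
  qed
  \<comment> \<open>A strictly increasing map of \<open>{1..n}\<close> into itself is the identity:
    the lower bound climbs from 1, the upper bound descends from \<open>n\<close>.\<close>
  have ge: "a \<le> s a" if "a \<in> {1..n}" for a
    using that
  proof (induction a)
    case (Suc a)
    then show ?case using mono[of a "Suc a"] s[of "Suc a"] by (cases "a = 0") auto
  qed simp
  have le: "s a \<le> a" if "a \<le> n" "1 \<le> a" for a
    using that
  proof (induction rule: inc_induct)
    case base
    then show ?case using s[of n] by simp
  next
    case (step a)
    then show ?case using mono[of a "Suc a"] by auto
  qed
  have "s a = a" if "a \<in> {1..n}" for a using ge[OF that] le[of a] that by auto
  then have "id_diagram n \<subseteq> D" using s by (fastforce simp: id_diagram_def)
  then show ?thesis using matching_subset_eq[OF M _ matching_id] by simp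
qed

lemma planar_cup:
  assumes "D \<in> tl_diagrams n" "D \<noteq> id_diagram n"
  shows "\<exists>k. 1 \<le> k \<and> k < n \<and> {Upper k, Upper (Suc k)} \<in> D"
proof -
  obtain a b where ab: "{Upper a, Upper b} \<in> D" using planar_no_cup assms by blast
  then have "a \<noteq> b" using matching_arc_points[OF tl_matching[OF assms(1)] ab] by simp
  then show ?thesis
    using planar_short_cup[OF assms(1), of a b] planar_short_cup[OF assms(1), of b a] ab
    by (cases "a < b") (auto simp: insert_commute)
qed

subsection \<open>Reflection and adding a strand\<close>

fun flip :: "point \<Rightarrow> point" where
  "flip (Upper i) = Lower i"
| "flip (Lower i) = Upper i"

fun stack_flip :: "stack_point \<Rightarrow> stack_point" where
  "stack_flip (Top i) = Bot i"
| "stack_flip (Mid i) = Mid i"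
| "stack_flip (Bot i) = Top i"

abbreviation flip_diagram :: "diagram \<Rightarrow> diagram" where
  "flip_diagram D \<equiv> image flip ` D"

lemma flip_flip [simp]: "flip (flip x) = x"
  by (cases x) auto

lemma flip_eq_iff [simp]: "flip x = flip y \<longleftrightarrow> x = y"
  by (metis flip_flip)

lemma flip_in_points [simp]: "flip x \<in> points n \<longleftrightarrow> x \<in> points n"
  by (cases x) (auto simp: points_def)

lemma flip_diagram_flip [simp]: "flip_diagram (flip_diagram D) = D"
  by (simp add: image_image)

lemma flip_diagram_id [simp]: "flip_diagram (id_diagram n) = id_diagram n"
  by (simp add: id_diagram_def setcompr_eq_image image_image insert_commute)

lemma flip_diagram_e [simp]: "flip_diagram (e_diagram n i) = e_diagram n i"
  by (simp add: e_diagram_def setcompr_eq_image image_image image_Un insert_commute)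

lemma arc_flip_iff: "{x, y} \<in> flip_diagram D \<longleftrightarrow> {flip x, flip y} \<in> D"
proof -
  have "inj (image flip)" by (rule injI) (simp add: inj_def inj_image_eq_iff)
  then have "flip ` {flip x, flip y} \<in> flip_diagram D \<longleftrightarrow> {flip x, flip y} \<in> D"
    by (rule inj_image_mem_iff)
  then show ?thesis by simp
qed

lemma matching_flip:
  assumes D: "perfect_matching n D"
  shows "perfect_matching n (flip_diagram D)"
proof (rule perfect_matchingI)
  fix A assume "A \<in> flip_diagram D"
  then obtain P where P: "P \<in> D" "A = flip ` P" by blast
  then obtain x y where "P = {x, y}" "x \<noteq> y" "x \<in> points n" "y \<in> points n"
    using matching_arcE[OF D] by metis
  then show "\<exists>x y. A = {x, y} \<and> x \<noteq> y \<and> x \<in> points n \<and> y \<in> points n"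
    using P by (intro exI[of _ "flip x"] exI[of _ "flip y"]) simp
next
  fix x assume "x \<in> points n"
  then obtain y where "{flip x, y} \<in> D" using matching_partner[OF D, of "flip x"] by auto
  then show "\<exists>A\<in>flip_diagram D. x \<in> A"
    by (intro bexI[of _ "flip ` {flip x, y}"] imageI) auto
next
  fix A B x assume "A \<in> flip_diagram D" "B \<in> flip_diagram D" "x \<in> A" "x \<in> B"
  then obtain P Q where "P \<in> D" "A = flip ` P" "Q \<in> D" "B = flip ` Q" "flip x \<in> P" "flip x \<in> Q"
    by auto
  then show "A = B" using matching_arc_eq[OF D, of P Q "flip x"] by simp
qed

lemma bpos_flip: "x \<in> points n \<Longrightarrow> bpos n (flip x) = 2 * n + 1 - bpos n x"
  by (cases x) (auto simp: points_def)

lemma bpos_le: "x \<in> points n \<Longrightarrow> bpos n x \<le> 2 * n"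
  by (cases x) (auto simp: points_def)

lemma planar_flip:
  assumes D: "D \<in> tl_diagrams n"
  shows "flip_diagram D \<in> tl_diagrams n"
proof (rule tl_diagramsI)
  show "perfect_matching n (flip_diagram D)" using matching_flip tl_matching D by blast
  fix a b c d assume "{a, b} \<in> flip_diagram D" "{c, d} \<in> flip_diagram D"
    and ord: "bpos n a < bpos n c" "bpos n c < bpos n b" "bpos n b < bpos n d"
  then have arcs: "{flip a, flip b} \<in> D" "{flip c, flip d} \<in> D" by (simp_all add: arc_flip_iff)
  then have pts: "a \<in> points n" "b \<in> points n" "c \<in> points n" "d \<in> points n"
    using matching_arc_points[OF tl_matching[OF D]] flip_in_points by metis+
  show False
    \<comment> \<open>Reflection reverses the boundary order, so the crossing is read backwards,
      from \<open>d\<close> to \<open>a\<close>.\<close>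
    using tl_noncrossing[OF D, of "flip d" "flip c" "flip b" "flip a"] arcs pts ord
      bpos_le[OF pts(1)] bpos_le[OF pts(2)] bpos_le[OF pts(3)] bpos_le[OF pts(4)]
    by (simp add: bpos_flip insert_commute) linarith
qed

lemma planar_cap:
  assumes D: "D \<in> tl_diagrams n" "D \<noteq> id_diagram n"
  shows "\<exists>k. 1 \<le> k \<and> k < n \<and> {Lower k, Lower (Suc k)} \<in> D"
proof -
  have "flip_diagram D \<noteq> id_diagram n" using D flip_diagram_flip flip_diagram_id by metis
  then show ?thesis using planar_cup[OF planar_flip[OF D(1)]] by (simp add: arc_flip_iff)
qed

lemma inj_stack_flip: "inj stack_flip"
proof (rule injI)
  show "x = y" if "stack_flip x = stack_flip y" for x y
    using that by (cases x; cases y) auto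
qed

lemma stack_flip_to [simp]:
  "stack_flip (to_top x) = to_bot (flip x)" "stack_flip (to_bot x) = to_top (flip x)"
  "stack_flip (to_outer x) = to_outer (flip x)"
  by (cases x; simp)+

text \<open>Reflecting a whole stack exchanges the two layers and fixes the middle edge; this is why
  reflection reverses products and preserves the number of loops.\<close>

lemma stack_arcs_flip:
  "stack_arcs (flip_diagram A) (flip_diagram B) = image stack_flip ` stack_arcs B A"
  by (simp add: stack_arcs_def image_Un image_image Un_commute)

lemma stack_diagram_flip:
  "stack_diagram n (flip_diagram A) (flip_diagram B) = flip_diagram (stack_diagram n B A)"
proof -
  have conn: "(to_outer (flip x), to_outer (flip y)) \<in> stack_conn (flip_diagram A) (flip_diagram B) \<longleftrightarrow>
      (to_outer x, to_outer y) \<in> stack_conn B A" for x y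
    using arc_conn_image[OF inj_stack_flip, of "to_outer x" "to_outer y"]
    by (simp add: stack_conn_eq stack_arcs_flip)
  show ?thesis
  proof (intro subset_antisym subsetI)
    fix E assume "E \<in> stack_diagram n (flip_diagram A) (flip_diagram B)"
    then obtain x y where "E = {x, y}" "{x, y} \<in> stack_diagram n (flip_diagram A) (flip_diagram B)"
      unfolding stack_diagram_def by blast
    then show "E \<in> flip_diagram (stack_diagram n B A)"
      using conn[of "flip x" "flip y"] by (simp add: arc_flip_iff stack_diagram_iff)
  next
    fix E assume "E \<in> flip_diagram (stack_diagram n B A)"
    then obtain x y where "E = {flip x, flip y}" "{x, y} \<in> stack_diagram n B A"
      unfolding stack_diagram_def by auto
    then show "E \<in> stack_diagram n (flip_diagram A) (flip_diagram B)"
      using conn[of x y] by (simp add: stack_diagram_iff)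
  qed
qed

lemma stack_loops_flip:
  "stack_loops n (flip_diagram A) (flip_diagram B) = stack_loops n B A"
proof -
  have loops: "stack_loops n A B = card (inner_comps (stack_arcs A B) (Mid ` {1..n}) (- range Mid))" for A B
    unfolding stack_loops_def inner_comps_def stack_conn_eq
    by (rule arg_cong[where f = card]) blast
  have "stack_flip -` (- range Mid) = - range Mid"
  proof (intro set_eqI)
    show "x \<in> stack_flip -` (- range Mid) \<longleftrightarrow> x \<in> - range Mid" for x
      by (cases x) auto
  qed
  moreover have "stack_flip ` (Mid ` {1..n}) = Mid ` {1..n}" by (simp add: image_image)
  ultimately show ?thesis
    using card_inner_comps_image[OF inj_stack_flip, of "stack_arcs B A" "Mid ` {1..n}" "- range Mid"]
    by (simp only: loops stack_arcs_flip)
qed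

text \<open>Generators are their own reflections, so left multiplication is read off from
  \<open>stack_e_cap\<close>.\<close>

lemma stack_e_cup:
  assumes "perfect_matching n D" "1 \<le> i" "i < n" "{Upper i, Upper (Suc i)} \<in> D"
  shows "stack_diagram n (e_diagram n i) D = D" "stack_loops n (e_diagram n i) D = 1"
proof -
  have "{Lower i, Lower (Suc i)} \<in> flip_diagram D" using assms by (simp add: arc_flip_iff)
  note cap = stack_e_cap[OF matching_flip[OF assms(1)] assms(2,3) this]
  show "stack_diagram n (e_diagram n i) D = D"
    using cap(1) stack_diagram_flip[of n "e_diagram n i" "flip_diagram D"]
    by simp
  show "stack_loops n (e_diagram n i) D = 1"
    using cap(2) stack_loops_flip[of n "e_diagram n i" "flip_diagram D"] by simp
qed

lemma stack_id_left:
  assumes "perfect_matching n D"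
  shows "stack_diagram n (id_diagram n) D = D" "stack_loops n (id_diagram n) D = 0"
proof -
  show "stack_diagram n (id_diagram n) D = D"
    using stack_id_right[OF matching_flip[OF assms]] stack_diagram_flip[of n "id_diagram n" "flip_diagram D"]
    by simp
  show "stack_loops n (id_diagram n) D = 0"
    using stack_loops_id_right[OF matching_flip[OF assms]] stack_loops_flip[of n "id_diagram n" "flip_diagram D"]
    by simp
qed

section \<open>Adding a vertical strand on the right\<close>

definition add_strand :: "nat \<Rightarrow> diagram \<Rightarrow> diagram" where
  "add_strand n D = insert {Upper (n + 1), Lower (n + 1)} D"

lemma points_Suc: "points (Suc n) = insert (Upper (Suc n)) (insert (Lower (Suc n)) (points n))"
  by (auto simp: points_def atLeastAtMostSuc_conv)

lemma new_not_in_points: "Upper (Suc n) \<notin> points n" "Lower (Suc n) \<notin> points n"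
  by (auto simp: points_def)

lemma matching_add_strand:
  assumes D: "perfect_matching n D"
  shows "perfect_matching (n + 1) (add_strand n D)"
proof (rule perfect_matchingI)
  fix A assume "A \<in> add_strand n D"
  then consider "A = {Upper (Suc n), Lower (Suc n)}" | "A \<in> D" unfolding add_strand_def by auto
  then show "\<exists>x y. A = {x, y} \<and> x \<noteq> y \<and> x \<in> points (n + 1) \<and> y \<in> points (n + 1)"
  proof cases
    case 1
    then show ?thesis
      by (intro exI[of _ "Upper (Suc n)"] exI[of _ "Lower (Suc n)"]) (simp add: points_Suc)
  next
    case 2
    then show ?thesis by (rule matching_arcE[OF D]) (simp add: points_Suc, blast)
  qed
next
  fix x assume "x \<in> points (n + 1)"
  then consider "x \<in> {Upper (Suc n), Lower (Suc n)}" | "x \<in> points n" by (auto simp: points_Suc)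
  then show "\<exists>A\<in>add_strand n D. x \<in> A"
  proof cases
    case 2
    then obtain y where "{x, y} \<in> D" using matching_partner[OF D] by blast
    then show ?thesis by (intro bexI[of _ "{x, y}"]) (auto simp: add_strand_def)
  qed (auto simp: add_strand_def)
next
  fix A B x assume *: "A \<in> add_strand n D" "B \<in> add_strand n D" "x \<in> A" "x \<in> B"
  have "Upper (Suc n) \<notin> P \<and> Lower (Suc n) \<notin> P" if "P \<in> D" for P
    using that matching_subset_Pow[OF D] new_not_in_points by blast
  then show "A = B" using * matching_arc_eq[OF D, of A B x] by (auto simp: add_strand_def)
qed

lemma bpos_Suc_less:
  "x \<in> points n \<Longrightarrow> y \<in> points n \<Longrightarrow> bpos (n + 1) x < bpos (n + 1) y \<longleftrightarrow> bpos n x < bpos n y"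
  by (cases x; cases y) (auto simp: points_def)

lemma planar_add_strand:
  assumes D: "D \<in> tl_diagrams n"
  shows "add_strand n D \<in> tl_diagrams (n + 1)"
proof (rule tl_diagramsI)
  note M = tl_matching[OF D]
  show M': "perfect_matching (n + 1) (add_strand n D)" by (rule matching_add_strand[OF M])
  fix a b c d assume ab: "{a, b} \<in> add_strand n D" and cd: "{c, d} \<in> add_strand n D"
    and ord: "bpos (n + 1) a < bpos (n + 1) c" "bpos (n + 1) c < bpos (n + 1) b"
      "bpos (n + 1) b < bpos (n + 1) d"
  have "{a, b} \<noteq> {Upper (Suc n), Lower (Suc n)}" "{c, d} \<noteq> {Upper (Suc n), Lower (Suc n)}"
    using ord by (auto simp: doubleton_eq_iff)
  then have arcs: "{a, b} \<in> D" "{c, d} \<in> D" using ab cd by (simp_all add: add_strand_def)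
  show False
    using tl_noncrossing[OF D arcs] ord matching_arc_points[OF M arcs(1)] matching_arc_points[OF M arcs(2)]
    by (simp only: bpos_Suc_less) blast
qed

text \<open>Multiplying by this generator changes only the arcs at the lower points \<open>i\<close>
  and \<open>i + 1\<close>. As \<open>i < n\<close>, the strand at \<open>n + 1\<close> is not among
  them.\<close>

lemma stack_add_strand_e:
  assumes D: "perfect_matching n D" and i: "1 \<le> i" "i < n"
  shows "stack_diagram (n + 1) (add_strand n D) (e_diagram (n + 1) i) =
      add_strand n (stack_diagram n D (e_diagram n i))"
    and "stack_loops (n + 1) (add_strand n D) (e_diagram (n + 1) i) = stack_loops n D (e_diagram n i)"
proof -
  have i': "i < n + 1" using i by simp
  note M' = matching_add_strand[OF D]
  obtain p where p: "{Lower i, p} \<in> D" by (rule matching_partner[OF D lower_points(1)[OF D i]])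
  obtain p' where p': "{Lower (Suc i), p'} \<in> D" by (rule matching_partner[OF D lower_points(2)[OF D i]])
  have pp: "{Lower i, p} \<in> add_strand n D" "{Lower (Suc i), p'} \<in> add_strand n D"
    using p p' by (simp_all add: add_strand_def)
  have "stack_diagram (n + 1) (add_strand n D) (e_diagram (n + 1) i) =
      add_strand n (stack_diagram n D (e_diagram n i)) \<and>
    stack_loops (n + 1) (add_strand n D) (e_diagram (n + 1) i) = stack_loops n D (e_diagram n i)"
  proof (cases "p = Lower (Suc i)")
    case True
    then show ?thesis using stack_e_cap[OF D i] stack_e_cap[OF M' i(1) i'] p pp by simp
  next
    case False
    have "{Upper (Suc n), Lower (Suc n)} \<noteq> {Lower i, p}" "{Upper (Suc n), Lower (Suc n)} \<noteq> {Lower (Suc i), p'}"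
      using i by (auto simp: doubleton_eq_iff)
    then have "cap_join i (add_strand n D) p p' = add_strand n (cap_join i D p p')"
      by (simp add: cap_join_def[OF D i] cap_join_def[OF M' i(1) i'])
        (simp add: add_strand_def insert_Diff_if insert_commute)
    then show ?thesis
      using stack_e_join[OF D i p p' False] stack_e_join[OF M' i(1) i' pp False]
        stack_loops_join[OF D i p p' False] stack_loops_join[OF M' i(1) i' pp False] by simp
  qed
  then show "stack_diagram (n + 1) (add_strand n D) (e_diagram (n + 1) i) =
      add_strand n (stack_diagram n D (e_diagram n i))"
    and "stack_loops (n + 1) (add_strand n D) (e_diagram (n + 1) i) = stack_loops n D (e_diagram n i)"
    by blast+
qed

lemma add_strand_id: "add_strand n (id_diagram n) = id_diagram (n + 1)"
  by (auto simp: add_strand_def id_diagram_def le_Suc_eq)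

subsection \<open>The diagrams \<open>g\<^bsub>n,i\<^esub>\<close>\<close>

definition vert :: "nat \<Rightarrow> point set" where "vert j = {Upper j, Lower j}"
definition shifted :: "nat \<Rightarrow> point set" where "shifted j = {Upper j, Lower (j + 2)}"

lemma arc_eq_simps [simp]:
  "vert j = vert k \<longleftrightarrow> j = k" "shifted j = shifted k \<longleftrightarrow> j = k"
  "vert j \<noteq> shifted k" "shifted j \<noteq> vert k"
  "{Upper a, Upper b} \<noteq> vert j" "{Lower a, Lower b} \<noteq> vert j"
  "{Upper a, Upper b} \<noteq> shifted j" "{Lower a, Lower b} \<noteq> shifted j"
  "vert j \<noteq> {Upper a, Upper b}" "vert j \<noteq> {Lower a, Lower b}"
  "shifted j \<noteq> {Upper a, Upper b}" "shifted j \<noteq> {Lower a, Lower b}"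
  "{Upper a, Upper b} \<noteq> {Lower c, Lower d}" "{Lower c, Lower d} \<noteq> {Upper a, Upper b}"
  by (auto simp: vert_def shifted_def doubleton_eq_iff)

lemma id_diagram_image: "id_diagram n = vert ` {1..n}"
  by (auto simp: id_diagram_def vert_def setcompr_eq_image)

lemma g_diagram_id: "g_diagram n n = vert ` {1..n}"
  by (simp add: g_diagram_def id_diagram_image)

lemma g_diagram_image:
  assumes "i \<noteq> n"
  shows "g_diagram n i = {{Upper (n - 1), Upper n}, {Lower i, Lower (i + 1)}} \<union>
    vert ` {1..<i} \<union> shifted ` {i..<n - 1}"
proof -
  have "{j. 1 \<le> j \<and> j < i} = {1..<i}" "{j. i \<le> j \<and> j + 2 \<le> n} = {i..<n - 1}" by auto
  then show ?thesis using assms by (simp add: g_diagram_def vert_def shifted_def setcompr_eq_image)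
qed


text \<open>The arcs shared by the \<open>g\<close> diagrams with indices \<open>i\<close> and
  \<open>i + 1\<close>. Each has just two further arcs, and multiplication by a generator exchanges
  one pair for the other.\<close>

definition g_rest :: "nat \<Rightarrow> nat \<Rightarrow> diagram" where
  "g_rest n i = insert {Upper (n - 1), Upper n} (vert ` {1..<i} \<union> shifted ` {i + 1..<n - 1})"

lemma g_diagram_rest:
  assumes "1 \<le> i" "i + 1 < n"
  shows "g_diagram n i = g_rest n i \<union> {{Lower i, Lower (i + 1)}, shifted i}"
    and "g_diagram n (i + 1) = g_rest n i \<union> {vert i, {Lower (i + 1), Lower (i + 2)}}"
proof -
  have "{i..<n - 1} = insert i {i + 1..<n - 1}" "{1..<i + 1} = insert i {1..<i}"
    using assms by auto
  then show "g_diagram n i = g_rest n i \<union> {{Lower i, Lower (i + 1)}, shifted i}"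
    "g_diagram n (i + 1) = g_rest n i \<union> {vert i, {Lower (i + 1), Lower (i + 2)}}"
    using assms by (simp_all add: g_diagram_image g_rest_def) auto
qed

lemma g_diagram_last:
  assumes "1 \<le> i"
  shows "g_diagram (i + 1) i =
      vert ` {1..<i} \<union> {{Upper i, Upper (i + 1)}, {Lower i, Lower (i + 1)}}"
    and "g_diagram (i + 1) (i + 1) = vert ` {1..<i} \<union> {vert i, vert (i + 1)}"
proof -
  have "{1..i + 1} = insert i (insert (i + 1) {1..<i})" using assms by auto
  then show "g_diagram (i + 1) (i + 1) = vert ` {1..<i} \<union> {vert i, vert (i + 1)}"
    by (simp add: g_diagram_def id_diagram_image)
qed (auto simp: g_diagram_image)

lemma cap_join_rest:
  assumes "perfect_matching n D" "1 \<le> i" "i < n"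
    and "D = D' \<union> {{Lower i, p}, {Lower (Suc i), p'}}" "{Lower i, p} \<notin> D'" "{Lower (Suc i), p'} \<notin> D'"
  shows "cap_join i D p p' = D' \<union> {{p, p'}, {Lower i, Lower (Suc i)}}"
  unfolding cap_join_def[OF assms(1-3)] using assms(4-6) by auto

lemma stack_e_rest:
  assumes D: "perfect_matching n D" and i: "1 \<le> i" "i < n"
    and eq: "D = D' \<union> {{Lower i, p}, {Lower (Suc i), p'}}"
    and notin: "{Lower i, p} \<notin> D'" "{Lower (Suc i), p'} \<notin> D'" and p: "p \<noteq> Lower (Suc i)"
  shows "stack_diagram n D (e_diagram n i) = D' \<union> {{p, p'}, {Lower i, Lower (Suc i)}}"
    and "stack_loops n D (e_diagram n i) = 0"
proof -
  have mem: "{Lower i, p} \<in> D" "{Lower (Suc i), p'} \<in> D" using eq by auto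
  show "stack_diagram n D (e_diagram n i) = D' \<union> {{p, p'}, {Lower i, Lower (Suc i)}}"
    unfolding stack_e_join[OF D i mem p] by (rule cap_join_rest[OF D i eq notin])
  show "stack_loops n D (e_diagram n i) = 0" by (rule stack_loops_join[OF D i mem p])
qed

lemma lower_vert: "{Lower j, Upper j} = vert j" "{Lower (Suc (Suc j)), Upper j} = shifted j"
  by (auto simp: vert_def shifted_def)

text \<open>That the \<open>g\<close> diagram is a perfect matching is a hypothesis, because
  planarity of these diagrams is itself derived from this relation. The case
  \<open>i + 1 = n\<close> is separate: there the left factor is the identity, which has no
  cup.\<close>

lemma g_e_down:
  assumes M: "perfect_matching n (g_diagram n (i + 1))" and i: "1 \<le> i" "i < n"
  shows "stack_diagram n (g_diagram n (i + 1)) (e_diagram n i) = g_diagram n i"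
    and "stack_loops n (g_diagram n (i + 1)) (e_diagram n i) = 0"
proof -
  have "stack_diagram n (g_diagram n (i + 1)) (e_diagram n i) = g_diagram n i \<and>
    stack_loops n (g_diagram n (i + 1)) (e_diagram n i) = 0"
  proof (cases "i + 1 = n")
    case True
    have eq: "g_diagram n (i + 1) = vert ` {1..<i} \<union>
        {{Lower i, Upper i}, {Lower (Suc i), Upper (Suc i)}}"
      using g_diagram_last(2)[OF i(1)] True unfolding lower_vert by simp
    have "{Lower i, Upper i} \<notin> vert ` {1..<i}" "{Lower (Suc i), Upper (Suc i)} \<notin> vert ` {1..<i}"
      unfolding lower_vert by auto
    then show ?thesis
      using stack_e_rest[OF M i eq] g_diagram_last(1)[OF i(1)] True by simp
  next
    case False
    then have i': "i + 1 < n" using i by simp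
    have eq: "g_diagram n (i + 1) = g_rest n i \<union>
        {{Lower i, Upper i}, {Lower (Suc i), Lower (i + 2)}}"
      unfolding g_diagram_rest(2)[OF i(1) i'] lower_vert by simp
    have "{Lower i, Upper i} \<notin> g_rest n i" "{Lower (Suc i), Lower (i + 2)} \<notin> g_rest n i"
      by (simp_all add: g_rest_def lower_vert image_iff)
    then show ?thesis
      using stack_e_rest[OF M i eq] g_diagram_rest(1)[OF i(1) i']
      by (simp add: shifted_def insert_commute)
  qed
  then show "stack_diagram n (g_diagram n (i + 1)) (e_diagram n i) = g_diagram n i"
    and "stack_loops n (g_diagram n (i + 1)) (e_diagram n i) = 0" by auto
qed

text \<open>Descent from the identity: each step to a smaller index is a multiplication by a
  generator, which preserves planarity.\<close>

lemma g_planar: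
  assumes "1 \<le> i" "i \<le> n"
  shows "g_diagram n i \<in> tl_diagrams n"
  using assms(2,1)
proof (induction rule: inc_induct)
  case base
  then show ?case using id_planar by (simp add: g_diagram_def)
next
  case (step i)
  then show ?case
    using stack_e_planar[of "g_diagram n (i + 1)" n i] g_e_down(1)[of n i]
      tl_matching[of "g_diagram n (i + 1)" n] by simp
qed

lemma g_e_up:
  assumes i: "1 \<le> i" "i + 1 < n"
  shows "stack_diagram n (g_diagram n i) (e_diagram n (i + 1)) = g_diagram n (i + 1)"
    and "stack_loops n (g_diagram n i) (e_diagram n (i + 1)) = 0"
proof -
  have M: "perfect_matching n (g_diagram n i)" using g_planar[of i n] tl_matching i by auto
  have eq: "g_diagram n i = g_rest n i \<union> {{Lower (i + 1), Lower i}, {Lower (Suc (i + 1)), Upper i}}"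
    using g_diagram_rest(1)[OF i] lower_vert(2)[of i] by (simp add: insert_commute)
  have "{Lower (i + 1), Lower i} \<notin> g_rest n i" "{Lower (Suc (i + 1)), Upper i} \<notin> g_rest n i"
    by (simp_all add: g_rest_def lower_vert image_iff)
  then show "stack_diagram n (g_diagram n i) (e_diagram n (i + 1)) = g_diagram n (i + 1)"
    "stack_loops n (g_diagram n i) (e_diagram n (i + 1)) = 0"
    using stack_e_rest[OF M _ i(2) eq] g_diagram_rest(2)[OF i] by (simp_all add: vert_def insert_commute)
qed

lemma g_e_same:
  assumes i: "1 \<le> i" "i < n"
  shows "stack_diagram n (g_diagram n i) (e_diagram n i) = g_diagram n i"
    and "stack_loops n (g_diagram n i) (e_diagram n i) = 1"
proof -
  have M: "perfect_matching n (g_diagram n i)" using g_planar[of i n] tl_matching i by auto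
  have "{Lower i, Lower (Suc i)} \<in> g_diagram n i" using i by (simp add: g_diagram_image)
  then show "stack_diagram n (g_diagram n i) (e_diagram n i) = g_diagram n i"
    "stack_loops n (g_diagram n i) (e_diagram n i) = 1"
    using stack_e_cap[OF M i] by auto
qed

text \<open>The strands ending at the lower points \<open>j\<close> and \<open>j + 1\<close> lead to
  adjacent upper points \<open>k\<close> and \<open>k + 1\<close>, which the cup of the generator
  joins. The bound \<open>k + 1 < n\<close> keeps this cup away from the last upper point, hence
  within reach of an idempotent on one strand fewer.\<close>

lemma g_e_far:
  assumes i: "1 \<le> i" "i \<le> n" and j: "1 \<le> j" "j < n" and far: "j + 1 < i \<or> i + 1 < j"
  shows "\<exists>k. 1 \<le> k \<and> k + 1 < n \<and>
    {Upper k, Upper (Suc k)} \<in> stack_diagram n (g_diagram n i) (e_diagram n j)"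
proof -
  have M: "perfect_matching n (g_diagram n i)" using g_planar[of i n] tl_matching i by auto
  have "\<exists>k. 1 \<le> k \<and> k + 1 < n \<and> {Lower j, Upper k} \<in> g_diagram n i \<and>
      {Lower (Suc j), Upper (Suc k)} \<in> g_diagram n i"
  proof (cases "j + 1 < i")
    case True
    then have "vert j \<in> g_diagram n i \<and> vert (Suc j) \<in> g_diagram n i"
      using i j by (cases "i = n") (simp_all add: g_diagram_image g_diagram_id)
    then show ?thesis using True i j unfolding lower_vert(1)[symmetric] by (intro exI[of _ j]) auto
  next
    case False
    \<comment> \<open>To the right of the cap at \<open>i\<close> the strands are shifted by
      two.\<close>
    define k where "k = j - 2"
    have k: "j = Suc (Suc k)" "i \<le> k" using False far by (auto simp: k_def)
    have "shifted k \<in> g_diagram n i" "shifted (Suc k) \<in> g_diagram n i"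
      using i j k by (simp_all add: g_diagram_image)
    then show ?thesis using k i j unfolding lower_vert(2)[symmetric] by (intro exI[of _ k]) auto
  qed
  then obtain k where k: "1 \<le> k" "k + 1 < n" "{Lower j, Upper k} \<in> g_diagram n i"
      "{Lower (Suc j), Upper (Suc k)} \<in> g_diagram n i" by blast
  have "{Upper k, Upper (Suc k)} \<in> stack_diagram n (g_diagram n i) (e_diagram n j)"
    unfolding stack_e_join[OF M j k(3,4) point.distinct(1)] cap_join_def[OF M j] by simp
  then show ?thesis using k by blast
qed

lemma g_cup: "{Upper k, Upper (Suc k)} \<in> g_diagram n i \<Longrightarrow> n \<le> Suc k"
  by (cases "i = n") (simp_all add: g_diagram_image g_diagram_id image_iff, auto simp: doubleton_eq_iff)

lemma g_diagram_inj:
  assumes "i \<in> {1..n}" "j \<in> {1..n}" "g_diagram n i = g_diagram n j"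
  shows "i = j"
proof -
  have cap: "a = b" if "b \<noteq> n" "g_diagram n a = g_diagram n b" for a b
  proof -
    have "{Lower b, Lower (b + 1)} \<in> g_diagram n a" using that by (simp add: g_diagram_image)
    then show ?thesis
      by (cases "a = n") (simp_all add: g_diagram_image g_diagram_id image_iff, auto simp: doubleton_eq_iff)
  qed
  show ?thesis using cap[of j i] cap[of i j] assms(3) by metis
qed

subsection \<open>Jones-Wenzl idempotents\<close>

lemma qvar_power: "qvar ^ k = Fract (monom 1 k) 1"
  by (induction k) (simp_all add: qvar_def One_fract_def monom_Suc mult.commute)

text \<open>The formal parameter is not a root of unity, by comparing degrees; all positive quantum
  integers are invertible for this reason.\<close>

lemma qvar_power_eq_1_iff: "qvar ^ k = 1 \<longleftrightarrow> k = 0"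
proof
  assume "qvar ^ k = 1"
  then have "monom (1 :: complex) k = 1" by (simp add: qvar_power One_fract_def eq_fract)
  then have "degree (monom (1 :: complex) k) = 0" by simp
  then show "k = 0" by (simp add: degree_monom_eq)
qed simp

lemma qvar_nonzero: "qvar \<noteq> 0"
  using qvar_power_eq_1_iff[of 2] by (auto simp: qvar_def Zero_fract_def eq_fract)

lemma qvar_diff_nonzero:
  assumes "n \<ge> 1" shows "qvar ^ n - 1 / qvar ^ n \<noteq> 0"
proof
  assume "qvar ^ n - 1 / qvar ^ n = 0"
  then have "qvar ^ n * qvar ^ n = 1" using qvar_nonzero by (simp add: field_simps)
  then show False using assms qvar_power_eq_1_iff[of "n + n"] by (simp add: power_add)
qed

lemma qint_0 [simp]: "qint 0 = 0"
  by (simp add: qint_def)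

lemma qint_nonzero: "n \<ge> 1 \<Longrightarrow> qint n \<noteq> 0"
  using qvar_diff_nonzero[of n] qvar_diff_nonzero[of 1] by (simp add: qint_def)

lemma qint_recurrence: "qint n + qint (Suc (Suc n)) = qint 2 * qint (Suc n)"
proof -
  have "(q ^ n - 1 / q ^ n) + (q ^ Suc (Suc n) - 1 / q ^ Suc (Suc n)) =
      (q + 1 / q) * (q ^ Suc n - 1 / q ^ Suc n)" if "q \<noteq> 0" for q :: ratfun
    using that by (simp add: field_simps)
  moreover have "qint 2 = qvar + 1 / qvar"
  proof -
    have "qvar ^ 2 - 1 / qvar ^ 2 = (qvar + 1 / qvar) * (qvar - 1 / qvar)"
      using qvar_nonzero by (simp add: field_simps power2_eq_square)
    then show ?thesis using qvar_diff_nonzero[of 1] by (simp add: qint_def)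
  qed
  ultimately show ?thesis
    using qvar_nonzero by (simp add: qint_def flip: add_divide_distrib)
qed

abbreviation delta :: ratfun where "delta \<equiv> - qint 2"

lemma delta_nonzero: "delta \<noteq> 0"
  using qint_nonzero[of 2] by simp

lemma tl_scale_eq_0: "tl_scale c x = 0 \<Longrightarrow> c \<noteq> 0 \<Longrightarrow> x = 0"
  by (metis tl.scale_scale tl.scale_one tl.scale_zero_right nonzero_divide_eq_eq)

section \<open>Absorption: the action on elements killed by all generators\<close>

lemma TL_keys: "x \<in> TL n \<Longrightarrow> Poly_Mapping.keys x \<subseteq> Pow (Pow (points n))"
  unfolding TL_def using matching_subset_Pow tl_matching by blast

lemma basis_in_TL: "D \<in> tl_diagrams n \<Longrightarrow> tl_basis D \<in> TL n"
  by (simp add: TL_def)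

lemma e_keys:
  assumes "i \<in> {1..<n}"
  shows "Poly_Mapping.keys (tl_basis (e_diagram n i)) \<subseteq> Pow (Pow (points n))"
  using assms by (auto simp: e_diagram_def points_def)

lemma tl_mult_id_right:
  assumes "x \<in> TL n"
  shows "tl_mult n x (tl_basis (id_diagram n)) = x"
proof (rule tl_linear_eqI[OF tl_linear_mult_left tl_linear_id])
  fix D assume "D \<in> Poly_Mapping.keys x"
  then have "perfect_matching n D" using assms tl_matching by (auto simp: TL_def)
  then show "tl_mult n (tl_basis D) (tl_basis (id_diagram n)) = tl_basis D"
    by (simp add: tl_mult_basis stack_prod_def stack_id_right stack_loops_id_right)
qed

lemma tl_mult_id_left:
  assumes "x \<in> TL n"
  shows "tl_mult n (tl_basis (id_diagram n)) x = x"
proof (rule tl_linear_eqI[OF tl_linear_mult_right tl_linear_id])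
  fix D assume "D \<in> Poly_Mapping.keys x"
  then have "perfect_matching n D" using assms tl_matching by (auto simp: TL_def)
  then show "tl_mult n (tl_basis (id_diagram n)) (tl_basis D) = tl_basis D"
    by (simp add: tl_mult_basis stack_prod_def stack_id_left)
qed

text \<open>The diagram \<open>D\<close> reproduces itself under the generator up to the invertible
  factor \<open>delta\<close>, and associativity moves that generator onto \<open>f\<close>.\<close>

lemma mult_cup_eq_0:
  assumes f: "f \<in> TL n" "tl_mult n f (tl_basis (e_diagram n k)) = 0"
    and D: "perfect_matching n D" and k: "k \<in> {1..<n}" "{Upper k, Upper (Suc k)} \<in> D"
  shows "tl_mult n f (tl_basis D) = 0"
proof -
  have "tl_mult n (tl_basis (e_diagram n k)) (tl_basis D) = tl_scale delta (tl_basis D)"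
    using stack_e_cup[OF D, of k] k by (simp add: tl_mult_basis stack_prod_def)
  then have "tl_scale delta (tl_mult n f (tl_basis D)) =
      tl_mult n f (tl_mult n (tl_basis (e_diagram n k)) (tl_basis D))"
    by (simp only: tl_mult_scale_right)
  also have "\<dots> = tl_mult n (tl_mult n f (tl_basis (e_diagram n k))) (tl_basis D)"
    using TL_keys[OF f(1)] e_keys[OF k(1)] matching_subset_Pow[OF D]
    by (intro tl_mult_assoc[symmetric]) auto
  finally have "tl_scale delta (tl_mult n f (tl_basis D)) = 0" using f(2) by simp
  then show ?thesis using delta_nonzero by (rule tl_scale_eq_0)
qed

lemma mult_cap_eq_0:
  assumes f: "f \<in> TL n" "tl_mult n (tl_basis (e_diagram n k)) f = 0"
    and D: "perfect_matching n D" and k: "k \<in> {1..<n}" "{Lower k, Lower (Suc k)} \<in> D"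
  shows "tl_mult n (tl_basis D) f = 0"
proof -
  have "tl_mult n (tl_basis D) (tl_basis (e_diagram n k)) = tl_scale delta (tl_basis D)"
    using stack_e_cap[OF D, of k] k by (simp add: tl_mult_basis stack_prod_def)
  then have "tl_scale delta (tl_mult n (tl_basis D) f) =
      tl_mult n (tl_mult n (tl_basis D) (tl_basis (e_diagram n k))) f"
    by (simp only: tl_mult_scale_left)
  also have "\<dots> = tl_mult n (tl_basis D) (tl_mult n (tl_basis (e_diagram n k)) f)"
    using TL_keys[OF f(1)] e_keys[OF k(1)] matching_subset_Pow[OF D]
    by (intro tl_mult_assoc) auto
  finally have "tl_scale delta (tl_mult n (tl_basis D) f) = 0" using f(2) by simp
  then show ?thesis using delta_nonzero by (rule tl_scale_eq_0)
qed

abbreviation id_coeff :: "nat \<Rightarrow> tl_elem \<Rightarrow> ratfun" where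
  "id_coeff n x \<equiv> Poly_Mapping.lookup x (id_diagram n)"

lemma tl_linear_id_coeff: "tl_linear (\<lambda>x. tl_scale (id_coeff n x) f)"
  by (rule tl_linearI) (simp_all add: lookup_add tl.scale_left_distrib)

text \<open>Every planar diagram other than the identity has a short cup and is therefore killed, so
  only the identity term of \<open>x\<close> acts.\<close>

lemma mult_right_absorb:
  assumes f: "f \<in> TL n" "\<And>i. i \<in> {1..<n} \<Longrightarrow> tl_mult n f (tl_basis (e_diagram n i)) = 0"
    and x: "x \<in> TL n"
  shows "tl_mult n f x = tl_scale (id_coeff n x) f"
proof (rule tl_linear_eqI[OF tl_linear_mult_right tl_linear_id_coeff])
  fix D assume "D \<in> Poly_Mapping.keys x"
  then have D: "D \<in> tl_diagrams n" using x by (auto simp: TL_def)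
  show "tl_mult n f (tl_basis D) = tl_scale (id_coeff n (tl_basis D)) f"
  proof (cases "D = id_diagram n")
    case True
    then show ?thesis using tl_mult_id_right[OF f(1)] by (simp add: lookup_tl_basis)
  next
    case False
    then obtain k where "k \<in> {1..<n}" "{Upper k, Upper (Suc k)} \<in> D"
      using planar_cup[OF D] by auto
    then show ?thesis
      using mult_cup_eq_0[OF f(1) f(2) tl_matching[OF D]] False by (simp add: lookup_tl_basis)
  qed
qed

lemma mult_left_absorb:
  assumes f: "f \<in> TL n" "\<And>i. i \<in> {1..<n} \<Longrightarrow> tl_mult n (tl_basis (e_diagram n i)) f = 0"
    and x: "x \<in> TL n"
  shows "tl_mult n x f = tl_scale (id_coeff n x) f"
proof (rule tl_linear_eqI[OF tl_linear_mult_left tl_linear_id_coeff])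
  fix D assume "D \<in> Poly_Mapping.keys x"
  then have D: "D \<in> tl_diagrams n" using x by (auto simp: TL_def)
  show "tl_mult n (tl_basis D) f = tl_scale (id_coeff n (tl_basis D)) f"
  proof (cases "D = id_diagram n")
    case True
    then show ?thesis using tl_mult_id_left[OF f(1)] by (simp add: lookup_tl_basis)
  next
    case False
    then obtain k where "k \<in> {1..<n}" "{Lower k, Lower (Suc k)} \<in> D"
      using planar_cap[OF D] by auto
    then show ?thesis
      using mult_cap_eq_0[OF f(1) f(2) tl_matching[OF D]] False by (simp add: lookup_tl_basis)
  qed
qed

section \<open>Reflection of elements; characterisation and uniqueness of the idempotent\<close>

definition flip_elem :: "tl_elem \<Rightarrow> tl_elem" where
  "flip_elem = lin_ext (\<lambda>D. tl_basis (flip_diagram D))"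

lemma tl_linear_flip: "tl_linear flip_elem"
  unfolding flip_elem_def by (rule tl_linear_lin_ext)

lemma flip_basis [simp]: "flip_elem (tl_basis D) = tl_basis (flip_diagram D)"
  by (simp add: flip_elem_def)

lemma flip_mult: "flip_elem (tl_mult n x y) = tl_mult n (flip_elem y) (flip_elem x)"
proof (rule tl_linear_eqI[of "\<lambda>x. flip_elem (tl_mult n x y)"])
  fix A
  show "flip_elem (tl_mult n (tl_basis A) y) = tl_mult n (flip_elem y) (flip_elem (tl_basis A))"
  proof (rule tl_linear_eqI[of "\<lambda>y. flip_elem (tl_mult n (tl_basis A) y)"])
    fix B
    show "flip_elem (tl_mult n (tl_basis A) (tl_basis B)) =
        tl_mult n (flip_elem (tl_basis B)) (flip_elem (tl_basis A))"
      by (simp add: tl_mult_basis stack_prod_def module_hom.scale[OF tl_linear_flip]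
          stack_diagram_flip stack_loops_flip)
  qed (rule tl_linear_comp[OF tl_linear_flip tl_linear_mult_right]
      tl_linear_comp[OF tl_linear_mult_left tl_linear_flip])+
qed (rule tl_linear_comp[OF tl_linear_flip tl_linear_mult_left]
    tl_linear_comp[OF tl_linear_mult_right tl_linear_flip])+

lemma lin_ext_in_TL:
  assumes "x \<in> TL m" "\<And>D. D \<in> tl_diagrams m \<Longrightarrow> F D \<in> TL n"
  shows "lin_ext F x \<in> TL n"
  unfolding lin_ext_def
  by (intro tl.subspace_sum[OF subspace_TL] tl.subspace_scale[OF subspace_TL] assms(2))
    (use assms(1) in \<open>auto simp: TL_def\<close>)

lemma flip_in_TL: "x \<in> TL n \<Longrightarrow> flip_elem x \<in> TL n"
  unfolding flip_elem_def by (erule lin_ext_in_TL) (intro basis_in_TL planar_flip)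

lemma id_coeff_flip: "id_coeff n (flip_elem x) = id_coeff n x"
proof -
  have "flip_diagram D = id_diagram n \<longleftrightarrow> D = id_diagram n" for D
    by (metis flip_diagram_flip flip_diagram_id)
  then have "id_coeff n (flip_elem x) =
      (\<Sum>D\<in>Poly_Mapping.keys x. if D = id_diagram n then Poly_Mapping.lookup x D else 0)"
    by (simp add: flip_elem_def lin_ext_def lookup_sum lookup_tl_basis if_distrib cong: if_cong)
  then show ?thesis by (simp add: in_keys_iff)
qed

text \<open>The invariant carried through the recursion: the normalisation of the identity
  coefficient stands in for idempotence and non-vanishing, and annihilation is demanded on one side
  only.\<close>

definition right_jw :: "nat \<Rightarrow> tl_elem \<Rightarrow> bool" where
  "right_jw n f \<longleftrightarrow> f \<in> TL n \<and> id_coeff n f = 1 \<and>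
    (\<forall>i\<in>{1..<n}. tl_mult n f (tl_basis (e_diagram n i)) = 0)"

text \<open>
  With \<open>h\<close> the reflection of \<open>f\<close>, the product \<open>f h\<close> equals \<open>f\<close> because \<open>f\<close> absorbs on the right
  and equals \<open>h\<close> because \<open>h\<close> absorbs on the left.
\<close>

lemma right_jw_imp_jw:
  assumes "right_jw n f" shows "is_jones_wenzl n f"
proof -
  from assms have f: "f \<in> TL n" "id_coeff n f = 1"
    "\<And>i. i \<in> {1..<n} \<Longrightarrow> tl_mult n f (tl_basis (e_diagram n i)) = 0"
    by (auto simp: right_jw_def)
  let ?h = "flip_elem f"
  have h: "?h \<in> TL n" "id_coeff n ?h = 1" using f by (simp_all add: flip_in_TL id_coeff_flip)
  have eh: "tl_mult n (tl_basis (e_diagram n i)) ?h = 0" if "i \<in> {1..<n}" for i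
    using flip_mult[of n f "tl_basis (e_diagram n i)"] f(3)[OF that]
    by (simp add: module_hom.zero[OF tl_linear_flip])
  have "tl_mult n f ?h = f" using mult_right_absorb[OF f(1,3) h(1)] h(2) by simp
  moreover have "tl_mult n f ?h = ?h" using mult_left_absorb[OF h(1) eh f(1)] f(2) by simp
  ultimately have "?h = f" by simp
  moreover have "tl_mult n f f = f" using mult_right_absorb[OF f(1,3) f(1)] f(2) by simp
  moreover have "f \<noteq> 0" using f(2) by auto
  ultimately show ?thesis using f eh by (simp add: is_jones_wenzl_def)
qed

text \<open>Absorption turns idempotence into c f = f, where c is the identity coefficient; since f
  is not 0, c = 1.\<close>

lemma jw_id_coeff:
  assumes "is_jones_wenzl n f" shows "id_coeff n f = 1"
proof -
  have "tl_scale (id_coeff n f) f = f"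
    using mult_right_absorb[of f n f] assms by (simp add: is_jones_wenzl_def)
  then have "tl_scale (id_coeff n f - 1) f = 0" by (simp add: tl.scale_left_diff_distrib)
  then show ?thesis using tl_scale_eq_0[of "id_coeff n f - 1" f] assms
    by (auto simp: is_jones_wenzl_def)
qed

text \<open>The product of the two candidates equals the left one by absorption on the right, and
  the right one by absorption on the left.\<close>

lemma jw_unique:
  assumes f: "is_jones_wenzl n f" and g: "is_jones_wenzl n g" shows "f = g"
proof -
  have "tl_mult n f g = f"
    using mult_right_absorb[of f n g] f g jw_id_coeff[OF g] by (simp add: is_jones_wenzl_def)
  moreover have "tl_mult n f g = g"
    using mult_left_absorb[of g n f] f g jw_id_coeff[OF f] by (simp add: is_jones_wenzl_def)
  ultimately show ?thesis by simp
qed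

lemma jones_wenzl_eqI: "right_jw n f \<Longrightarrow> jones_wenzl n = f"
  unfolding jones_wenzl_def using right_jw_imp_jw jw_unique by (intro the_equality) blast+

subsection \<open>The recursion\<close>

lemma tl_embed_lin_ext: "tl_embed n = lin_ext (\<lambda>D. tl_basis (add_strand n D))"
  by (rule ext) (simp add: tl_embed_def lin_ext_def add_strand_def)

lemma tl_linear_embed: "tl_linear (tl_embed n)"
  unfolding tl_embed_lin_ext by (rule tl_linear_lin_ext)

lemma embed_basis [simp]: "tl_embed n (tl_basis D) = tl_basis (add_strand n D)"
  by (simp add: tl_embed_lin_ext)

lemma embed_in_TL: "x \<in> TL n \<Longrightarrow> tl_embed n x \<in> TL (n + 1)"
  unfolding tl_embed_lin_ext by (erule lin_ext_in_TL) (intro basis_in_TL planar_add_strand)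

lemma embed_mult_e:
  assumes x: "x \<in> TL n" and i: "i \<in> {1..<n}"
  shows "tl_mult (n + 1) (tl_embed n x) (tl_basis (e_diagram (n + 1) i)) =
    tl_embed n (tl_mult n x (tl_basis (e_diagram n i)))"
proof (rule tl_linear_eqI[OF tl_linear_comp[OF tl_linear_mult_left tl_linear_embed]
      tl_linear_comp[OF tl_linear_embed tl_linear_mult_left]])
  fix D assume "D \<in> Poly_Mapping.keys x"
  then have "perfect_matching n D" using x tl_matching by (auto simp: TL_def)
  then show "tl_mult (n + 1) (tl_embed n (tl_basis D)) (tl_basis (e_diagram (n + 1) i)) =
      tl_embed n (tl_mult n (tl_basis D) (tl_basis (e_diagram n i)))"
    using stack_add_strand_e[of n D i] i
    by (simp add: tl_mult_basis stack_prod_def module_hom.scale[OF tl_linear_embed])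
qed

text \<open>Stacking on a \<open>g\<close> diagram is a chain of multiplications by generators, by
  \<open>g_e_down\<close> and associativity, so planarity follows one generator at a time.\<close>

lemma stack_g_planar:
  assumes D: "D \<in> tl_diagrams n" and "1 \<le> i" "i \<le> n"
  shows "stack_diagram n D (g_diagram n i) \<in> tl_diagrams n"
  using assms(3,2)
proof (induction rule: inc_induct)
  case base
  then show ?case using D by (simp add: g_diagram_def stack_id_right tl_matching)
next
  case (step i)
  have g: "perfect_matching n (g_diagram n (i + 1))" using g_planar[of "i + 1" n] step tl_matching by simp
  have "e_diagram n i \<subseteq> Pow (points n)" using e_keys[of i n] step by simp
  then have "stack_diagram n D (g_diagram n i) =
      stack_diagram n (stack_diagram n D (g_diagram n (i + 1))) (e_diagram n i)"
    using g_e_down(1)[OF g] step stack_diagram_assoc[OF matching_subset_Pow[OF tl_matching[OF D]]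
        matching_subset_Pow[OF g], of "e_diagram n i"] by simp
  then show ?case using stack_e_planar[of _ n i] step by simp
qed

lemma stack_cup:
  assumes "perfect_matching n A" "{Upper a, Upper b} \<in> A"
  shows "{Upper a, Upper b} \<in> stack_diagram n A B"
proof -
  have "to_top ` {Upper a, Upper b} \<in> stack_arcs A B" using assms(2) unfolding stack_arcs_def by blast
  then have "(Top a, Top b) \<in> stack_conn A B" unfolding stack_conn_eq by (auto intro: arc_conn_arc)
  then show ?thesis using matching_arc_points[OF assms] by (simp add: stack_diagram_iff)
qed

text \<open>
  Every diagram other than the identity has a cup among the first \<open>n\<close> upper points, which
  survives right multiplication but does not occur in \<open>g\<^bsub>n+1,j\<^esub>\<close>.
\<close>

lemma coeff_embed_mult_g:
  assumes x: "x \<in> TL n" and i: "i \<in> {1..n + 1}" and j: "j \<in> {1..n + 1}"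
  shows "Poly_Mapping.lookup (tl_mult (n + 1) (tl_embed n x) (tl_basis (g_diagram (n + 1) i)))
      (g_diagram (n + 1) j) = (if i = j then id_coeff n x else 0)"
proof -
  let ?F = "\<lambda>D. stack_prod (n + 1) (add_strand n D) (g_diagram (n + 1) i)"
  have "tl_mult (n + 1) (tl_embed n x) (tl_basis (g_diagram (n + 1) i)) = lin_ext ?F x"
    by (rule tl_linear_eqI[OF tl_linear_comp[OF tl_linear_mult_left tl_linear_embed] tl_linear_lin_ext])
      (simp add: tl_mult_basis)
  moreover have "Poly_Mapping.lookup (?F D) (g_diagram (n + 1) j) =
      (if D = id_diagram n then if i = j then 1 else 0 else 0)" if "D \<in> Poly_Mapping.keys x" for D
  proof (cases "D = id_diagram n")
    case True
    have "perfect_matching (n + 1) (g_diagram (n + 1) i)" using g_planar[of i "n + 1"] i tl_matching by auto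
    from stack_id_left[OF this] show ?thesis
      using True g_diagram_inj[OF i j]
      by (auto simp: add_strand_id stack_prod_def lookup_tl_basis simp del: One_nat_def add_Suc_right)
  next
    case False
    have D: "D \<in> tl_diagrams n" using that x by (auto simp: TL_def)
    then obtain k where k: "k < n" "{Upper k, Upper (Suc k)} \<in> D" using planar_cup False by blast
    have "{Upper k, Upper (Suc k)} \<in> stack_diagram (n + 1) (add_strand n D) (g_diagram (n + 1) i)"
      using matching_add_strand[OF tl_matching[OF D]] k by (intro stack_cup) (simp_all add: add_strand_def)
    then have "stack_diagram (n + 1) (add_strand n D) (g_diagram (n + 1) i) \<noteq> g_diagram (n + 1) j"
      using g_cup[of k "n + 1" j] k by auto
    then show ?thesis using False by (simp add: stack_prod_def lookup_tl_basis)
  qed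
  ultimately have "Poly_Mapping.lookup (tl_mult (n + 1) (tl_embed n x) (tl_basis (g_diagram (n + 1) i)))
      (g_diagram (n + 1) j) = (\<Sum>D\<in>Poly_Mapping.keys x. Poly_Mapping.lookup x D *
        (if D = id_diagram n then if i = j then 1 else 0 else 0))"
    by (simp add: lin_ext_def lookup_sum)
  also have "\<dots> = (\<Sum>D\<in>Poly_Mapping.keys x. if D = id_diagram n then
      (if i = j then Poly_Mapping.lookup x D else 0) else 0)"
    by (rule sum.cong) auto
  also have "\<dots> = (if i = j then id_coeff n x else 0)"
    by (simp add: in_keys_iff)
  finally show ?thesis .
qed

section \<open>The recursion step: coefficients and annihilation\<close>

definition wenzl_step :: "nat \<Rightarrow> tl_elem \<Rightarrow> tl_elem" where
  "wenzl_step n f = tl_mult (n + 1) (tl_scale (1 / qint (n + 1)) (tl_embed n f))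
     (\<Sum>i = 1..n + 1. tl_scale (qint i) (tl_basis (g_diagram (n + 1) i)))"

lemma wenzl_step_sum:
  "wenzl_step n f = tl_scale (1 / qint (n + 1)) (\<Sum>i = 1..n + 1.
     tl_scale (qint i) (tl_mult (n + 1) (tl_embed n f) (tl_basis (g_diagram (n + 1) i))))"
  unfolding wenzl_step_def
  by (simp only: tl_mult_scale_left tl_mult_sum_right tl_mult_scale_right tl.scale_sum_right
      tl.scale_scale mult.commute)

lemma coeff_wenzl_step:
  assumes "f \<in> TL n" "id_coeff n f = 1" "j \<in> {1..n + 1}"
  shows "Poly_Mapping.lookup (wenzl_step n f) (g_diagram (n + 1) j) = qint j / qint (n + 1)"
proof -
  have "Poly_Mapping.lookup (wenzl_step n f) (g_diagram (n + 1) j) =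
      1 / qint (n + 1) * (\<Sum>i = 1..n + 1. qint i * (if i = j then id_coeff n f else 0))"
    unfolding wenzl_step_sum
    using coeff_embed_mult_g[OF assms(1) _ assms(3)] by (simp add: lookup_sum del: sum.cl_ivl_Suc)
  also have "(\<Sum>i = 1..n + 1. qint i * (if i = j then id_coeff n f else 0)) =
      (\<Sum>i = 1..n + 1. if i = j then qint i else 0)"
    using assms(2) by (intro sum.cong) auto
  also have "\<dots> = qint j" using assms(3) by (simp del: sum.cl_ivl_Suc)
  finally show ?thesis by simp
qed

lemma wenzl_step_in_TL:
  assumes f: "f \<in> TL n" shows "wenzl_step n f \<in> TL (n + 1)"
proof -
  have "tl_mult (n + 1) (tl_embed n f) (tl_basis (g_diagram (n + 1) i)) \<in> TL (n + 1)"
    if "i \<in> {1..n + 1}" for i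
    unfolding tl_mult_lin_ext_left lin_ext_basis
    by (rule lin_ext_in_TL[OF embed_in_TL[OF f]])
      (use that in \<open>auto simp: stack_prod_def intro!: tl.subspace_scale[OF subspace_TL] basis_in_TL stack_g_planar\<close>)
  then show ?thesis
    unfolding wenzl_step_sum
    by (intro tl.subspace_scale[OF subspace_TL] tl.subspace_sum[OF subspace_TL])
qed

lemma wenzl_step_mult_e:
  assumes f: "right_jw n f" and n: "n \<ge> 1" and j: "j \<in> {1..<n + 1}"
  shows "tl_mult (n + 1) (wenzl_step n f) (tl_basis (e_diagram (n + 1) j)) = 0"
proof -
  let ?N = "n + 1" and ?F = "tl_embed n f"
  let ?e = "tl_basis (e_diagram ?N j)" and ?g = "\<lambda>i. tl_basis (g_diagram ?N i)"
  let ?Fg = "\<lambda>i. tl_mult ?N ?F (?g i)"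
  have fTL: "f \<in> TL n" using f by (simp add: right_jw_def)
  have F: "?F \<in> TL ?N" by (rule embed_in_TL[OF fTL])
  have Fe: "tl_mult ?N ?F (tl_basis (e_diagram ?N k)) = 0" if "k \<in> {1..<n}" for k
    using embed_mult_e[OF fTL that] f that
    by (simp add: right_jw_def module_hom.zero[OF tl_linear_embed])
  \<comment> \<open>The factor by which the generator carries the \<open>i\<close>-th term to the
    \<open>j\<close>-th one. For \<open>j = 1\<close> the last condition reads \<open>i = 0\<close>,
    an index outside the sum.\<close>
  define c where "c i = (if i = j + 1 then 1 else 0) + (if i = j then delta else 0) +
    (if i = j - 1 then 1 else (0 :: ratfun))" for i
  have summand: "tl_mult ?N (?Fg i) ?e = tl_scale (c i) (?Fg j)" if i: "i \<in> {1..?N}" for i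
  proof -
    have g: "perfect_matching ?N (g_diagram ?N i)" using g_planar[of i ?N] i tl_matching by auto
    have "tl_mult ?N (?Fg i) ?e = tl_mult ?N ?F (tl_mult ?N (?g i) ?e)"
      using TL_keys[OF F] e_keys[OF j] matching_subset_Pow[OF g] by (intro tl_mult_assoc) auto
    also have "\<dots> = tl_scale (c i) (?Fg j)"
    proof -
      consider "i = j + 1" | "i = j" | "i + 1 = j" | "j + 1 < i \<or> i + 1 < j" by linarith
      then show ?thesis
      proof cases
        case 1
        then have "tl_mult ?N (?g i) ?e = ?g j"
          using g_e_down[of ?N j] g j by (simp add: tl_mult_basis stack_prod_def)
        moreover have "c i = 1" using 1 by (auto simp: c_def)
        ultimately show ?thesis by simp
      next
        case 2
        then have "tl_mult ?N (?g i) ?e = tl_scale delta (?g j)"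
          using g_e_same[of j ?N] j by (simp add: tl_mult_basis stack_prod_def)
        moreover have "c i = delta" using 2 j by (auto simp: c_def)
        ultimately show ?thesis by (simp only: tl_mult_scale_right)
      next
        case 3
        then have "tl_mult ?N (?g i) ?e = ?g j"
          using g_e_up[of i ?N] i j by (simp add: tl_mult_basis stack_prod_def)
        moreover have "c i = 1" using 3 i by (auto simp: c_def)
        ultimately show ?thesis by simp
      next
        case 4
        let ?S = "stack_diagram ?N (g_diagram ?N i) (e_diagram ?N j)"
        obtain k where k: "1 \<le> k" "k + 1 < ?N" "{Upper k, Upper (Suc k)} \<in> ?S"
          using g_e_far[of i ?N j] i j 4 by auto
        have "perfect_matching ?N ?S"
          using stack_e_planar[OF g_planar[of i ?N]] i j tl_matching by auto
        \<comment> \<open>The bound on \<open>k\<close> places the cup among the first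
          \<open>n\<close> upper points, where the embedded idempotent still kills it.\<close>
        then have "tl_mult ?N ?F (tl_basis ?S) = 0"
          using mult_cup_eq_0[OF F Fe] k by auto
        moreover have "c i = 0" using 4 by (auto simp: c_def)
        ultimately show ?thesis by (simp add: tl_mult_basis stack_prod_def tl_mult_scale_right)
      qed
    qed
    finally show ?thesis .
  qed
  have "(\<Sum>i = 1..?N. qint i * c i) =
      (\<Sum>i = 1..?N. (if i = j + 1 then qint i else 0) + (if i = j then delta * qint i else 0) +
        (if i = j - 1 then qint i else 0))"
    by (rule sum.cong) (auto simp: c_def algebra_simps)
  also have "\<dots> = qint (j + 1) + delta * qint j + qint (j - 1)"
  proof -
    \<comment> \<open>When \<open>j - 1 = 0\<close> the corresponding term is absent from the sum,
      which agrees with \<open>qint 0 = 0\<close>.\<close>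
    have "j + 1 \<in> {1..?N}" "j \<in> {1..?N}" "j - 1 \<in> {1..?N} \<or> j - 1 = 0" using j by auto
    then show ?thesis by (auto simp: sum.distrib simp del: sum.cl_ivl_Suc)
  qed
  also have "\<dots> = 0" using qint_recurrence[of "j - 1"] j by (simp add: algebra_simps)
  finally have zero: "(\<Sum>i = 1..?N. qint i * c i) = 0" .
  have "tl_mult ?N (wenzl_step n f) ?e =
      tl_scale (1 / qint ?N) (\<Sum>i = 1..?N. tl_scale (qint i) (tl_mult ?N (?Fg i) ?e))"
    unfolding wenzl_step_sum
    by (simp only: tl_mult_scale_left module_hom.sum[OF tl_linear_mult_left])
  also have "(\<Sum>i = 1..?N. tl_scale (qint i) (tl_mult ?N (?Fg i) ?e)) =
      tl_scale (\<Sum>i = 1..?N. qint i * c i) (?Fg j)"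
    unfolding tl.scale_sum_left by (rule sum.cong) (simp_all only: summand tl.scale_scale)
  finally show ?thesis by (simp only: zero tl.scale_zero_left tl.scale_zero_right)
qed

lemma right_jw_step:
  assumes f: "right_jw n f" and n: "n \<ge> 1"
  shows "right_jw (n + 1) (wenzl_step n f)"
proof -
  have fTL: "f \<in> TL n" "id_coeff n f = 1" using f by (simp_all add: right_jw_def)
  \<comment> \<open>The identity is the \<open>g\<close> diagram of top index, so its coefficient is
    [n+1]/[n+1].\<close>
  have "id_coeff (n + 1) (wenzl_step n f) = 1"
    using coeff_wenzl_step[OF fTL, of "n + 1"] qint_nonzero[of "n + 1"] by (simp add: g_diagram_def)
  then show ?thesis
    using wenzl_step_in_TL[OF fTL(1)] wenzl_step_mult_e[OF f n] unfolding right_jw_def by blast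
qed

text \<open>Existence: each stage exhibits an explicit element, which uniqueness then identifies
  with the description in \<open>jones_wenzl\<close>. On one strand there are no generators, so the
  identity serves as the start.\<close>

lemma right_jw_jones_wenzl:
  assumes "n \<ge> 1" shows "right_jw n (jones_wenzl n)"
  using assms
proof (induction rule: dec_induct)
  case base
  have "right_jw 1 (tl_basis (id_diagram 1))"
    using basis_in_TL[OF id_planar] by (simp add: right_jw_def lookup_tl_basis)
  then show ?case using jones_wenzl_eqI by metis
next
  case (step n)
  then show ?case using right_jw_step[of n] jones_wenzl_eqI by (metis Suc_eq_plus1)
qed

lemma jones_wenzl_Suc: "n \<ge> 1 \<Longrightarrow> jones_wenzl (n + 1) = wenzl_step n (jones_wenzl n)"
  by (intro jones_wenzl_eqI right_jw_step right_jw_jones_wenzl)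

lemma coeff_jones_wenzl:
  assumes "1 \<le> i" "i \<le> n"
  shows "Poly_Mapping.lookup (jones_wenzl n) (g_diagram n i) = qint i / qint n"
proof (cases "n = 1")
  case True
  then have "g_diagram n i = id_diagram n" "i = n" using assms by (simp_all add: g_diagram_def)
  then show ?thesis
    using right_jw_jones_wenzl[of n] True qint_nonzero[of n] by (simp add: right_jw_def)
next
  case False
  then obtain m where m: "n = m + 1" "m \<ge> 1" using assms by (cases n) auto
  then show ?thesis
    using coeff_wenzl_step[of "jones_wenzl m" m i] right_jw_jones_wenzl[OF m(2)] assms
    by (simp only: jones_wenzl_Suc right_jw_def) simp
qed

theorem proposition3p3:
  "(\<forall>n i. 1 \<le> i \<and> i \<le> n \<longrightarrow>
      Poly_Mapping.lookup (jones_wenzl n) (g_diagram n i) = qint i / qint n) \<and>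
   (\<forall>n\<ge>1. jones_wenzl (n + 1) =
      tl_mult (n + 1)
        (tl_scale (1 / qint (n + 1)) (tl_embed n (jones_wenzl n)))
        (\<Sum>i = 1..n + 1. tl_scale (qint i) (tl_basis (g_diagram (n + 1) i))))"
  using coeff_jones_wenzl jones_wenzl_Suc unfolding wenzl_step_def by blast

end
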